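(* Let $\mathbb{F}_q$ be a finite field with $q$ elements, let $n>1$ and $1\le d<n$ be integers, and let $\alpha\in\mathbb{F}_{q^n}$ be a root of an irreducible polynomial of degree $n$ over $\mathbb{F}_q$. Assume $n<q^{d/2}+1$. Then the diameter $D$ of $G_d(n,q,\alpha)$ satisfies \[D\leq 2\frac{n}{d}+1+\frac{4\frac{n}{d}\log{(n-1)}}{d\log{q}-2\log(n-1)}.\]
   Context: $\Gamma_f=\mathbb{F}_q[\alpha]^*=\mathbb{F}_{q^n}^*$. A polynomial of positive degree is primary if it is a power of an irreducible polynomial. $P_d$ is the set of monic primary polynomials of degree $d$ in $\mathbb{F}_q[x]$, and $E_d=\{g(\alpha): g\in P_d\}$. $G_d(n,q,\alpha)$ is the directed graph with vertex set $\Gamma_f$ and edges $\beta_1\to\beta_2$ whenever $\beta_2/\beta_1\in E_d$. The diameter $D$ is the minimal integer (or $\infty$) such that every element of $\Gamma_f$ can be written as a product of at most $D$ elements of $E_d$. *)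

theory Defs
  imports
    Complex_Main
    "HOL-Library.Cardinality"
    "HOL-Library.Extended_Real"
    "HOL-Computational_Algebra.Computational_Algebra"
    "Subresultants.More_Homomorphisms"
    "Graph_Theory.Arc_Walk"
begin

text \<open>
  The base field with \<open>q\<close> elements is a type \<open>'a\<close>, the field with \<open>q\<^sup>n\<close> elements is a type \<open>'b\<close>,
  and the inclusion of the former in the latter is a field homomorphism \<open>\<iota>\<close>.
\<close>

definition eval_at :: "('a::field \<Rightarrow> 'b::field) \<Rightarrow> 'b \<Rightarrow> 'a poly \<Rightarrow> 'b" where
  "eval_at \<iota> \<alpha> g = poly (map_poly \<iota> g) \<alpha>"

definition primary_poly :: "'a::field poly \<Rightarrow> bool" where
  "primary_poly g \<longleftrightarrow> degree g > 0 \<and> (\<exists>p k. irreducible p \<and> g = p ^ k)"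

definition P_set :: "nat \<Rightarrow> 'a::field poly set" where
  "P_set d = {g. lead_coeff g = 1 \<and> primary_poly g \<and> degree g = d}"

definition E_set :: "('a::field \<Rightarrow> 'b::field) \<Rightarrow> 'b \<Rightarrow> nat \<Rightarrow> 'b set" where
  "E_set \<iota> \<alpha> d = eval_at \<iota> \<alpha> ` P_set d"

definition Gamma_set :: "('a::field \<Rightarrow> 'b::field) \<Rightarrow> 'b \<Rightarrow> 'b set" where
  "Gamma_set \<iota> \<alpha> = range (eval_at \<iota> \<alpha>) - {0}"

definition G_graph :: "('a::field \<Rightarrow> 'b::field) \<Rightarrow> 'b \<Rightarrow> nat \<Rightarrow> ('b, 'b \<times> 'b) pre_digraph" where
  "G_graph \<iota> \<alpha> d =
     \<lparr>verts = Gamma_set \<iota> \<alpha>,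
      arcs = {(\<beta>1, \<beta>2). \<beta>1 \<in> Gamma_set \<iota> \<alpha> \<and> \<beta>2 \<in> Gamma_set \<iota> \<alpha> \<and> \<beta>2 / \<beta>1 \<in> E_set \<iota> \<alpha> d},
      tail = fst, head = snd\<rparr>"

lemma G_graph_simps:
  "verts (G_graph \<iota> \<alpha> d) = Gamma_set \<iota> \<alpha>"
  "e \<in> arcs (G_graph \<iota> \<alpha> d) \<longleftrightarrow> fst e \<in> Gamma_set \<iota> \<alpha> \<and> snd e \<in> Gamma_set \<iota> \<alpha> \<and>
     snd e / fst e \<in> E_set \<iota> \<alpha> d"
  "tail (G_graph \<iota> \<alpha> d) = fst" "head (G_graph \<iota> \<alpha> d) = snd"
  by (auto simp: G_graph_def)

text \<open>
  The infimum of the empty set in \<^typ>\<open>enat\<close> is \<open>\<infinity>\<close>. Repeated factors are allowed, and the empty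
  product counts as a product of at most \<open>k\<close> elements.
\<close>

definition G_diameter :: "('a::field \<Rightarrow> 'b::field) \<Rightarrow> 'b \<Rightarrow> nat \<Rightarrow> enat" where
  "G_diameter \<iota> \<alpha> d =
     Inf {enat k | k. \<forall>\<beta>\<in>Gamma_set \<iota> \<alpha>.
            \<exists>xs. length xs \<le> k \<and> set xs \<subseteq> E_set \<iota> \<alpha> d \<and> prod_list xs = \<beta>}"

text \<open>
  The next lemmas confirm that the vertex set is the whole multiplicative group of \<open>'b\<close> and that
  the diameter is the usual one of the digraph, the supremum of the directed distances.
\<close>

lemma Gamma_set_eq:
  fixes \<iota> :: "'a::{field,finite} \<Rightarrow> 'b::{field,finite}"
  assumes \<iota>: "field_hom \<iota>" and f: "irreducible f" "eval_at \<iota> \<alpha> f = 0"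
    and card: "CARD('b) = CARD('a) ^ degree f"
  shows "Gamma_set \<iota> \<alpha> = - {0}"
proof -
  interpret field_hom \<iota> by fact
  interpret mh: map_poly_inj_comm_ring_hom \<iota> ..
  define V where "V = {g::'a poly. degree g < degree f}"
  have f0: "f \<noteq> 0" using f by auto
  have degf: "degree f > 0"
    using f f0 by (metis is_unit_iff_degree irreducible_def neq0_conv)
  have cardV: "card V = CARD('a) ^ degree f"
  proof -
    let ?L = "{xs::'a list. length xs = degree f}"
    have "bij_betw (\<lambda>g. map (coeff g) [0..<degree f]) V ?L"
    proof (rule bij_betwI[where g = Poly])
      show "Poly \<in> ?L \<rightarrow> V"
      proof
        fix xs :: "'a list" assume xs: "xs \<in> ?L"
        have "degree (Poly xs) \<le> degree f - 1"
          using xs by (intro degree_le) (auto simp: coeff_Poly_eq nth_default_def)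
        then show "Poly xs \<in> V" using degf by (auto simp: V_def)
      qed
    next
      fix g assume "g \<in> V"
      then show "Poly (map (coeff g) [0..<degree f]) = g"
        by (intro poly_eqI) (auto simp: V_def coeff_Poly_eq nth_default_def coeff_eq_0)
    next
      fix xs :: "'a list" assume "xs \<in> ?L"
      then show "map (coeff (Poly xs)) [0..<degree f] = xs"
        by (intro nth_equalityI) (auto simp: coeff_Poly_eq nth_default_def)
    qed auto
    then have "card V = card ?L" by (rule bij_betw_same_card)
    also have "\<dots> = CARD('a) ^ degree f"
      using card_lists_length_eq[of "UNIV :: 'a set" "degree f"] by simp
    finally show ?thesis .
  qed
  have "inj_on (eval_at \<iota> \<alpha>) V"
  proof (rule inj_onI)
    fix g h assume gh: "g \<in> V" "h \<in> V" "eval_at \<iota> \<alpha> g = eval_at \<iota> \<alpha> h"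
    then have ev: "eval_at \<iota> \<alpha> (g - h) = 0" by (simp add: eval_at_def hom_distribs)
    have deg: "degree (g - h) < degree f"
      using gh degree_diff_less by (auto simp: V_def)
    show "g = h"
    proof (rule ccontr)
      assume "g \<noteq> h"
      define Q where "Q = (\<lambda>p. p \<noteq> 0 \<and> eval_at \<iota> \<alpha> p = 0)"
      have "Q (g - h)" using \<open>g \<noteq> h\<close> ev by (simp add: Q_def)
      then obtain m where m: "Q m" and least: "\<And>p. Q p \<Longrightarrow> degree m \<le> degree p"
        by (metis arg_min_natI arg_min_nat_le)
      have m0: "m \<noteq> 0" "eval_at \<iota> \<alpha> m = 0" using m by (auto simp: Q_def)
      have dm: "degree m < degree f" using least[OF \<open>Q (g - h)\<close>] deg by simp
      have "eval_at \<iota> \<alpha> (f div m * m + f mod m) =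
          eval_at \<iota> \<alpha> (f div m) * eval_at \<iota> \<alpha> m + eval_at \<iota> \<alpha> (f mod m)"
        by (simp only: eval_at_def mh.hom_mult mh.hom_add poly_mult poly_add)
      then have "eval_at \<iota> \<alpha> (f mod m) = 0"
        using f(2) m0 by (simp only: div_mult_mod_eq mult_zero_right add_0)
      then have "f mod m = 0"
        using least[of "f mod m"] degree_mod_less'[of m f] m0(1) by (force simp: Q_def)
      then have fe: "f = f div m * m" by (metis add.right_neutral div_mult_mod_eq)
      then consider "is_unit m" | "is_unit (f div m)" using f(1) irreducibleD by blast
      then show False
      proof cases
        case 1
        then obtain c where "m * c = 1" by (metis dvdE)
        then have "eval_at \<iota> \<alpha> (m * c) = 1" by (simp add: eval_at_def)
        then show False using m0 by (simp add: eval_at_def mh.hom_mult)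
      next
        case 2
        then have "degree (f div m) = 0" using f0 fe
          by (metis is_unit_iff_degree mult_zero_left)
        then have "degree f = degree m" using fe f0 m0
          by (metis add_0 degree_mult_eq mult_zero_left)
        then show False using dm by simp
      qed
    qed
  qed
  then have "card (eval_at \<iota> \<alpha> ` V) = CARD('b)" using cardV card by (simp add: card_image)
  then have "eval_at \<iota> \<alpha> ` V = UNIV" by (intro card_subset_eq) auto
  then have "range (eval_at \<iota> \<alpha>) = UNIV" by auto
  then show ?thesis by (auto simp: Gamma_set_def)
qed

lemma awalk_iff_prod_list:
  assumes "Gamma_set \<iota> \<alpha> = - {0}" "\<beta>1 \<noteq> 0" "\<beta>2 \<noteq> 0"
  shows "(\<exists>w. pre_digraph.awalk (G_graph \<iota> \<alpha> d) \<beta>1 w \<beta>2 \<and> length w = k) \<longleftrightarrow>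
         (\<exists>xs. length xs = k \<and> set xs \<subseteq> E_set \<iota> \<alpha> d \<and> prod_list xs = \<beta>2 / \<beta>1)"
  using assms(2,3)
proof (induction k arbitrary: \<beta>1)
  case 0
  interpret wf_digraph "G_graph \<iota> \<alpha> d" by unfold_locales (auto simp: G_graph_simps)
  have "(\<exists>w. awalk \<beta>1 w \<beta>2 \<and> length w = 0) \<longleftrightarrow> \<beta>1 = \<beta>2"
    using 0 assms(1) by (simp add: awalk_Nil_iff G_graph_simps)
  moreover have "(\<exists>xs. length xs = 0 \<and> set xs \<subseteq> E_set \<iota> \<alpha> d \<and> prod_list xs = \<beta>2 / \<beta>1) \<longleftrightarrow> \<beta>1 = \<beta>2"
    using 0 by (simp add: eq_divide_eq)
  ultimately show ?case by simp
next
  case (Suc k)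
  interpret wf_digraph "G_graph \<iota> \<alpha> d" by unfold_locales (auto simp: G_graph_simps)
  have "(\<exists>w. awalk \<beta>1 w \<beta>2 \<and> length w = Suc k) \<longleftrightarrow>
        (\<exists>\<gamma>. \<gamma> \<noteq> 0 \<and> \<gamma> / \<beta>1 \<in> E_set \<iota> \<alpha> d \<and> (\<exists>w. awalk \<gamma> w \<beta>2 \<and> length w = k))"
    (is "?L \<longleftrightarrow> ?R")
  proof
    assume ?L
    then obtain e w where "awalk \<beta>1 (e # w) \<beta>2" "length w = k" by (auto simp: length_Suc_conv)
    then show ?R using assms(1) by (auto simp: awalk_Cons_iff G_graph_simps)
  next
    assume ?R
    then obtain \<gamma> w where "\<gamma> \<noteq> 0" "\<gamma> / \<beta>1 \<in> E_set \<iota> \<alpha> d" "awalk \<gamma> w \<beta>2" "length w = k" by auto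
    then have "awalk \<beta>1 ((\<beta>1, \<gamma>) # w) \<beta>2 \<and> length ((\<beta>1, \<gamma>) # w) = Suc k"
      using assms(1) Suc.prems by (auto simp: awalk_Cons_iff G_graph_simps)
    then show ?L by blast
  qed
  also have "\<dots> \<longleftrightarrow> (\<exists>\<gamma>. \<gamma> \<noteq> 0 \<and> \<gamma> / \<beta>1 \<in> E_set \<iota> \<alpha> d \<and>
      (\<exists>xs. length xs = k \<and> set xs \<subseteq> E_set \<iota> \<alpha> d \<and> prod_list xs = \<beta>2 / \<gamma>))"
    using Suc.IH Suc.prems by blast
  also have "\<dots> \<longleftrightarrow> (\<exists>xs. length xs = Suc k \<and> set xs \<subseteq> E_set \<iota> \<alpha> d \<and> prod_list xs = \<beta>2 / \<beta>1)"
    (is "?L \<longleftrightarrow> ?R")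
  proof
    assume ?L
    then obtain \<gamma> xs where "\<gamma> \<noteq> 0" "\<gamma> / \<beta>1 \<in> E_set \<iota> \<alpha> d" "length xs = k"
      "set xs \<subseteq> E_set \<iota> \<alpha> d" "prod_list xs = \<beta>2 / \<gamma>" by auto
    then show ?R by (intro exI[of _ "(\<gamma> / \<beta>1) # xs"]) auto
  next
    assume ?R
    then obtain x xs where x: "length xs = k" "x \<in> E_set \<iota> \<alpha> d"
      "set xs \<subseteq> E_set \<iota> \<alpha> d" "x * prod_list xs = \<beta>2 / \<beta>1" by (auto simp: length_Suc_conv)
    then have "x \<noteq> 0" using Suc.prems by auto
    then show ?L using x Suc.prems
      by (intro exI[of _ "x * \<beta>1"] conjI exI[of _ xs]) (auto simp: field_simps)
  qed
  finally show ?case .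
qed

lemma G_diameter_eq_SUP_distance:
  assumes "Gamma_set \<iota> \<alpha> = - {0}"
  shows "G_diameter \<iota> \<alpha> d =
    (SUP u \<in> verts (G_graph \<iota> \<alpha> d). SUP v \<in> verts (G_graph \<iota> \<alpha> d).
       INF w \<in> {w. pre_digraph.awalk (G_graph \<iota> \<alpha> d) u w v}. enat (length w))"
    (is "_ = ?S")
proof -
  let ?A = "pre_digraph.awalk (G_graph \<iota> \<alpha> d)"
  let ?P = "\<lambda>k \<beta>. \<exists>xs. length xs \<le> k \<and> set xs \<subseteq> E_set \<iota> \<alpha> d \<and> prod_list xs = \<beta>"
  have Inf_le: "Inf X \<le> enat k \<longleftrightarrow> (\<exists>x\<in>X. x \<le> enat k)" for X :: "enat set" and k
  proof
    assume le: "Inf X \<le> enat k"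
    then have "X \<noteq> {}" by (auto simp: Inf_enat_def)
    then have "Inf X \<in> X" by (auto simp: Inf_enat_def intro: LeastI)
    then show "\<exists>x\<in>X. x \<le> enat k" using le by blast
  qed (auto intro: Inf_lower2)
  have Inf_enat_iff: "(\<exists>x\<in>{enat j | j. R j}. x \<le> enat k) \<longleftrightarrow> (\<exists>j\<le>k. R j)" for R k
  proof
    assume "\<exists>j\<le>k. R j"
    then obtain j where "R j" "j \<le> k" by blast
    then show "\<exists>x\<in>{enat j | j. R j}. x \<le> enat k"
      by (intro bexI[of _ "enat j"]) auto
  qed auto
  have walk: "(\<exists>w. ?A u w v \<and> length w \<le> k) \<longleftrightarrow> ?P k (v / u)" if "u \<noteq> 0" "v \<noteq> 0" for u v k
    using awalk_iff_prod_list[OF assms that, of d] by metis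
  have main: "G_diameter \<iota> \<alpha> d \<le> enat k \<longleftrightarrow> ?S \<le> enat k" for k
  proof -
    have "G_diameter \<iota> \<alpha> d \<le> enat k \<longleftrightarrow> (\<exists>j\<le>k. \<forall>\<beta>. \<beta> \<noteq> 0 \<longrightarrow> ?P j \<beta>)"
      unfolding G_diameter_def Inf_le assms Inf_enat_iff by (simp add: Ball_def)
    also have "\<dots> \<longleftrightarrow> (\<forall>\<beta>. \<beta> \<noteq> 0 \<longrightarrow> ?P k \<beta>)"
      by (meson le_trans order_refl)
    also have "\<dots> \<longleftrightarrow> (\<forall>u v. u \<noteq> 0 \<longrightarrow> v \<noteq> 0 \<longrightarrow> ?P k (v / u))"
      by (metis div_by_1 divide_eq_0_iff one_neq_zero)
    also have "\<dots> \<longleftrightarrow> (\<forall>u v. u \<noteq> 0 \<longrightarrow> v \<noteq> 0 \<longrightarrow> (\<exists>w. ?A u w v \<and> length w \<le> k))"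
      using walk by blast
    also have "\<dots> \<longleftrightarrow> ?S \<le> enat k"
      using assms by (auto simp: SUP_le_iff Inf_le G_graph_simps)
    finally show ?thesis .
  qed
  show ?thesis
  proof (rule antisym)
    show "G_diameter \<iota> \<alpha> d \<le> ?S"
    proof (cases ?S)
      case (enat k)
      then show ?thesis using main[of k] by (simp only: order_refl)
    next
      case infinity
      show ?thesis unfolding infinity by simp
    qed
    show "?S \<le> G_diameter \<iota> \<alpha> d"
    proof (cases "G_diameter \<iota> \<alpha> d")
      case (enat k)
      then show ?thesis using main[of k] by (simp only: order_refl)
    next
      case infinity
      show ?thesis unfolding infinity by simp
    qed
  qed
qed

end

theory Submission
  imports "HOL-Algebra.Algebraic_Closure_Type"
    "HOL-Computational_Algebra.Fundamental_Theorem_Algebra" Defs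
begin

text \<open>
  Let \<open>S\<^sub>d(\<chi>)\<close> be the sum of \<open>deg p \<cdot> \<chi>(p(\<alpha>)\<^sup>j)\<close> over all monic irreducible \<open>p\<close> and \<open>j \<ge> 1\<close> with
  \<open>j deg p = d\<close>. If \<open>\<bar>S\<^sub>d(\<chi>)\<bar> \<le> (n - 1) q\<^bsup>d/2\<^esup>\<close> for every nontrivial character \<open>\<chi>\<close> of the
  multiplicative group of the big field, then, by orthogonality of characters, every \<open>\<beta>\<close> is a
  product of \<open>k\<close> elements of \<open>E\<^sub>d\<close> as soon as \<open>q\<^bsup>dk\<^esup> \<ge> q\<^sup>n ((n - 1) q\<^bsup>d/2\<^esup>)\<^sup>k\<close>.

  Since \<open>\<chi>\<close> sums to zero over residues modulo \<open>f\<close>, the \<open>L\<close>-function of \<open>\<chi>\<close> is a polynomial of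
  degree less than \<open>n\<close>, and \<open>-S\<^sub>d(\<chi>)\<close> is the \<open>d\<close>-th power sum of its inverse roots. Hence it suffices
  that \<open>S\<^sub>r(\<chi>) = O(q\<^bsup>r/2\<^esup>)\<close> for \<open>r = 2nt\<close>. With \<open>R = q\<^sup>r\<close> and \<open>E = (R - 1)/(q\<^sup>n - 1)\<close>, the value
  \<open>p(\<alpha>)\<^sup>j\<close> at a root \<open>x\<close> of \<open>p\<close> is \<open>G(x)\<^sup>E\<close>, where \<open>G\<close> is the product of the \<open>\<alpha> - X^(q\<^sup>j)\<close>, \<open>j < n\<close>.
  Stepanov's method bounds the number of \<open>x\<close> with \<open>x\<^sup>R = x\<close> and \<open>G(x)\<^sup>E = c\<close> by
  \<open>R/(q\<^sup>n - 1) + O(\<surd>R)\<close>; these numbers sum to \<open>R\<close> over all \<open>c\<close>, so the upper bounds force lower ones.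
\<close>

section \<open>Primary polynomials and their power sums\<close>

definition monics :: "nat \<Rightarrow> 'a::field poly set" where
  "monics k = {g. lead_coeff g = 1 \<and> degree g = k}"

text \<open>Pairs stand in for the powers \<open>p ^ j\<close>, so that base and exponent are at
  hand without factoring.\<close>

definition primary_pairs :: "nat \<Rightarrow> ('a::field poly \<times> nat) set" where
  "primary_pairs r = {(p, j). irreducible p \<and> lead_coeff p = 1 \<and> j \<ge> 1 \<and> j * degree p = r}"

text \<open>With L(T) the sum of F(g) T^(deg g) over monic \<open>g\<close>, these are, for
  multiplicative \<open>F\<close>, the coefficients of T L' / L.\<close>

definition primary_sum :: "('a::field poly \<Rightarrow> complex) \<Rightarrow> nat \<Rightarrow> complex" where
  "primary_sum F r = (\<Sum>(p, j)\<in>primary_pairs r. of_nat (degree p) * F p ^ j)"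

definition primary_divisors :: "'a::field poly \<Rightarrow> ('a poly \<times> nat) set" where
  "primary_divisors g = {(p, j). irreducible p \<and> lead_coeff p = 1 \<and> j \<ge> 1 \<and> p ^ j dvd g}"

lemma monics_0: "monics 0 = {1}"
  by (auto simp: monics_def elim!: degree_eq_zeroE)

lemma monics_Suc: "monics (Suc k) = (\<lambda>(a, h). pCons a h) ` (UNIV \<times> monics k)"
proof -
  have "pCons a h \<in> monics (Suc k) \<longleftrightarrow> h \<in> monics k" for a and h :: "'a poly"
    by (cases "h = 0") (auto simp: monics_def)
  moreover have "\<exists>a h. g = pCons a h" for g :: "'a poly"
    by (meson pCons_cases)
  ultimately show ?thesis by (fastforce simp: image_iff)
qed

lemma finite_card_monics:
  "finite (monics k :: 'a::{field,finite} poly set) \<and> card (monics k :: 'a poly set) = CARD('a) ^ k"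
proof (induction k)
  case (Suc k)
  have "inj_on (\<lambda>(a, h). pCons a h) (UNIV \<times> (monics k :: 'a poly set))"
    by (auto simp: inj_on_def)
  with Suc show ?case
    by (simp add: monics_Suc card_image card_cartesian_product)
qed (simp add: monics_0)

lemmas finite_monics = finite_card_monics[THEN conjunct1]
lemmas card_monics = finite_card_monics[THEN conjunct2]

lemma irreducible_degree_pos:
  fixes p :: "'a::field poly"
  assumes "irreducible p"
  shows "degree p > 0"
  using assms by (metis gr0I irreducible_def is_unit_iff_degree)

lemma finite_primary_pairs:
  assumes "r > 0"
  shows "finite (primary_pairs r :: ('a::{field,finite} poly \<times> nat) set)"
proof -
  have "primary_pairs r \<subseteq> (\<Union>k\<in>{..r}. (monics k :: 'a poly set)) \<times> {..r}"
    using assms by (auto simp: primary_pairs_def monics_def)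
  then show ?thesis by (rule finite_subset) (simp add: finite_monics)
qed

section \<open>Prime powers dividing a polynomial\<close>

lemma irreducible_monic_dvd_eq:
  fixes p p' :: "'a::field poly"
  assumes "irreducible p" "irreducible p'" "lead_coeff p = 1" "lead_coeff p' = 1" "p dvd p'"
  shows "p = p'"
proof -
  obtain c where c: "p' = p * c" using assms(5) by (elim dvdE)
  then have "is_unit c" using assms(1,2) by (metis irreducibleD irreducible_not_unit)
  then obtain a where "c = [:a:]" by (metis is_unit_poly_iff)
  then have "a = 1" using c assms(3,4) lead_coeff_mult[of p c] by simp
  then show ?thesis using c \<open>c = [:a:]\<close> by simp
qed

lemma prime_elem_power_dvd_mult:
  fixes p :: "'a::field poly"
  assumes "prime_elem p" "\<not> p dvd a" "p ^ j dvd a * h"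
  shows "p ^ j dvd h"
  using assms(3)
proof (induction j)
  case (Suc j)
  then have "p ^ j dvd h" by (meson dvd_trans le_imp_power_dvd lessI less_imp_le)
  then obtain h' where h': "h = p ^ j * h'" by (elim dvdE)
  have "p ^ j * p dvd p ^ j * (a * h')" using Suc.prems by (simp add: h' ac_simps)
  moreover have "p ^ j \<noteq> 0" using assms(1) by (simp add: prime_elem_not_zeroI)
  ultimately have "p dvd a * h'" by (metis dvd_times_left_cancel_iff)
  then have "p dvd h'" using assms(1,2) by (metis prime_elem_dvd_multD)
  then show ?case by (simp add: h' mult.commute mult_dvd_mono)
qed simp

text \<open>With \<open>m\<close> the multiplicity of \<open>p\<close> in \<open>h\<close>, only the
  exponent \<open>Suc m\<close> is new: a power of another monic irreducible divides
  \<open>p * h\<close> exactly when it divides \<open>h\<close>.\<close>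

lemma primary_divisors_mult:
  fixes p h :: "'a::field poly"
  assumes p: "irreducible p" "lead_coeff p = 1" and h: "h \<noteq> 0"
  shows "\<exists>m. primary_divisors (p * h) = insert (p, Suc m) (primary_divisors h) \<and>
    (p, Suc m) \<notin> primary_divisors h"
proof -
  have p0: "p \<noteq> 0" using p(1) by auto
  have "finite {j. p ^ j dvd h}"
  proof (rule finite_subset)
    show "{j. p ^ j dvd h} \<subseteq> {..degree h}"
    proof
      fix j assume "j \<in> {j. p ^ j dvd h}"
      then have "j * degree p \<le> degree h"
        using h dvd_imp_degree_le[of "p ^ j" h] by (simp add: degree_power_eq p0 mult.commute)
      then show "j \<in> {..degree h}"
        using irreducible_degree_pos[OF p(1)] by (cases "degree p") auto
    qed
  qed simp
  moreover have "0 \<in> {j. p ^ j dvd h}" by simp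
  ultimately obtain m where m: "p ^ m dvd h" "\<And>j. p ^ j dvd h \<Longrightarrow> j \<le> m"
    by (metis Max_ge Max_in empty_iff mem_Collect_eq)
  have pow: "p ^ j dvd h \<longleftrightarrow> j \<le> m" for j
    using m by (meson dvd_trans le_imp_power_dvd)
  have pow': "p ^ j dvd p * h \<longleftrightarrow> j \<le> Suc m" for j
    using p0 pow by (cases j) auto
  have other: "p' ^ j dvd p * h \<longleftrightarrow> p' ^ j dvd h"
    if "irreducible p'" "lead_coeff p' = 1" "p' \<noteq> p" for p' j
  proof -
    have pr': "prime_elem p'" using that(1) by (rule field_poly_irreducible_imp_prime)
    have "\<not> p' dvd p" using irreducible_monic_dvd_eq[OF that(1) p(1) that(2) p(2)] that(3) by auto
    then show ?thesis using prime_elem_power_dvd_mult[OF pr', of p j h] dvd_mult by blast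
  qed
  have "(p', j) \<in> primary_divisors (p * h) \<longleftrightarrow>
      (p', j) \<in> insert (p, Suc m) (primary_divisors h)" for p' j
  proof (cases "p' = p")
    case True
    then show ?thesis using p by (auto simp: primary_divisors_def pow pow')
  next
    case False
    then show ?thesis using other by (auto simp: primary_divisors_def)
  qed
  moreover have "(p, Suc m) \<notin> primary_divisors h" by (simp add: primary_divisors_def pow)
  ultimately show ?thesis by (metis surj_pair subset_antisym subsetI)
qed

lemma exists_monic_irreducible_factor:
  fixes g :: "'a::field poly"
  assumes "lead_coeff g = 1" "degree g > 0"
  shows "\<exists>p h. irreducible p \<and> lead_coeff p = 1 \<and> lead_coeff h = 1 \<and> g = p * h"
proof -
  obtain p where p: "irreducible p" "p dvd g"
    using assms(2) by (metis dvd_refl irreducible\<^sub>d_factor irreducible_connect_field dvd_triv_left)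
  define p' where "p' = Polynomial.smult (inverse (lead_coeff p)) p"
  have p0: "p \<noteq> 0" using p(1) by auto
  have p': "irreducible p'" "lead_coeff p' = 1" "p' dvd g"
    using p p0 by (auto simp: p'_def smult_dvd_iff)
  then obtain h where "g = p' * h" by (elim dvdE)
  then show ?thesis using p' assms(1) by (metis lead_coeff_mult mult_1)
qed

text \<open>The analogue of summing the von Mangoldt function over the divisors of an integer.
  Splitting off a monic irreducible factor removes one pair, whose weight is the degree
  lost.\<close>

lemma sum_primary_divisors:
  fixes g :: "'a::field poly"
  assumes "lead_coeff g = 1"
  shows "finite (primary_divisors g) \<and> (\<Sum>(p, j)\<in>primary_divisors g. degree p) = degree g"
  using assms
proof (induction "degree g" arbitrary: g rule: less_induct)
  case less
  show ?case
  proof (cases "degree g = 0")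
    case True
    then have "g = 1" using less.prems by (auto elim!: degree_eq_zeroE)
    have "\<not> p ^ j dvd 1" if "irreducible p" "j \<ge> 1" for p :: "'a poly" and j
      using that by (metis irreducible_not_unit is_unit_power_iff not_one_le_zero)
    then have "primary_divisors g = {}" using \<open>g = 1\<close> by (auto simp: primary_divisors_def)
    then show ?thesis using True by simp
  next
    case False
    then obtain p h where ph: "irreducible p" "lead_coeff p = 1" "lead_coeff h = 1" "g = p * h"
      using exists_monic_irreducible_factor less.prems by blast
    have h0: "h \<noteq> 0" "p \<noteq> 0" using ph by auto
    have dg: "degree g = degree p + degree h" using ph h0 by (simp add: degree_mult_eq)
    then have "degree h < degree g" using irreducible_degree_pos[OF ph(1)] by simp
    then have IH: "finite (primary_divisors h)" "(\<Sum>(p, j)\<in>primary_divisors h. degree p) = degree h"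
      using less.hyps ph(3) by auto
    obtain m where m: "primary_divisors g = insert (p, Suc m) (primary_divisors h)"
      "(p, Suc m) \<notin> primary_divisors h"
      using primary_divisors_mult[OF ph(1,2) h0(1)] ph(4) by blast
    show ?thesis using m IH dg by simp
  qed
qed

lemma primary_pairs_monic:
  assumes "(p, j) \<in> primary_pairs r"
  shows "p ^ j \<in> monics r"
proof -
  have "p \<noteq> 0" using assms by (auto simp: primary_pairs_def)
  then show ?thesis
    using assms lead_coeff_power[of p j] by (auto simp: primary_pairs_def monics_def degree_power_eq)
qed

text \<open>This is T L' = (T L' / L) L, read off coefficientwise. Each \<open>g\<close> has degree
  \<open>k\<close>, which is the sum of the weights of its prime power divisors; after exchanging
  the sums, \<open>g\<close> is \<open>p ^ j\<close> times a monic polynomial of degree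
  \<open>k - r\<close>.\<close>

lemma primary_sum_recurrence:
  fixes F :: "'a::{field,finite} poly \<Rightarrow> complex"
  assumes F: "\<And>g h. F (g * h) = F g * F h" "F 1 = 1"
  shows "of_nat k * (\<Sum>g\<in>monics k. F g) =
    (\<Sum>r=1..k. primary_sum F r * (\<Sum>g\<in>monics (k - r). F g))"
proof -
  have Fp: "F (p ^ j) = F p ^ j" for p j by (induction j) (auto simp: F)
  have inner: "(\<Sum>g | g \<in> monics k \<and> p ^ j dvd g. F g) = F p ^ j * (\<Sum>g\<in>monics (k - r). F g)"
    if pj: "(p, j) \<in> primary_pairs r" and r: "r \<le> k" for p :: "'a poly" and j r
  proof -
    have "p \<noteq> 0" using pj by (auto simp: primary_pairs_def)
    then have m: "p ^ j \<noteq> 0" "degree (p ^ j) = r" "lead_coeff (p ^ j) = 1"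
      using primary_pairs_monic[OF pj] by (auto simp: monics_def)
    have "{g. g \<in> monics k \<and> p ^ j dvd g} = (\<lambda>h. p ^ j * h) ` monics (k - r)"
    proof (intro equalityI subsetI)
      fix g assume "g \<in> {g. g \<in> monics k \<and> p ^ j dvd g}"
      then have g: "p ^ j dvd g" "lead_coeff g = 1" "degree g = k" by (auto simp: monics_def)
      then obtain h where h: "g = p ^ j * h" by (elim dvdE)
      note h = h g(2,3)
      then have "h \<noteq> 0" by auto
      then have "h \<in> monics (k - r)" using h m by (auto simp: monics_def degree_mult_eq lead_coeff_mult)
      then show "g \<in> (\<lambda>h. p ^ j * h) ` monics (k - r)" using h by blast
    next
      fix g assume "g \<in> (\<lambda>h. p ^ j * h) ` monics (k - r)"
      then obtain h where h: "g = p ^ j * h" "lead_coeff h = 1" "degree h = k - r"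
        unfolding monics_def by blast
      then have "h \<noteq> 0" by auto
      then show "g \<in> {g. g \<in> monics k \<and> p ^ j dvd g}"
        using h m r lead_coeff_mult[of "p ^ j" h] by (auto simp: monics_def degree_mult_eq)
    qed
    moreover have "inj_on (\<lambda>h. p ^ j * h) (monics (k - r))" using m by (auto simp: inj_on_def)
    ultimately show ?thesis
      by (simp add: sum.reindex sum_distrib_left F Fp)
  qed
  \<comment> \<open>One finite index set for all \<open>g\<close> of degree \<open>k\<close>, so
    that the sums can be exchanged.\<close>
  define U where "U = (SIGMA r:{1..k}. (primary_pairs r :: ('a poly \<times> nat) set))"
  have finU: "finite U" by (auto simp: U_def finite_primary_pairs)
  have PD: "(\<Sum>(p, j)\<in>primary_divisors g. of_nat (degree p)) =
      (\<Sum>(r, p, j)\<in>U. if p ^ j dvd g then of_nat (degree p) else (0::complex))" if g: "g \<in> monics k" for g :: "'a poly"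
  proof -
    have g0: "g \<noteq> 0" "degree g = k" using g by (auto simp: monics_def)
    have deg: "1 \<le> j * degree p \<and> j * degree p \<le> k" if "(p, j) \<in> primary_divisors g" for p j
      using that irreducible_degree_pos[of p] g0 dvd_imp_degree_le[of "p ^ j" g]
      by (cases "p = 0") (auto simp: primary_divisors_def degree_power_eq mult.commute)
    have "(\<Sum>(r, p, j)\<in>U. if p ^ j dvd g then of_nat (degree p) else (0::complex)) =
        (\<Sum>(r, p, j)\<in>{(r, p, j) \<in> U. p ^ j dvd g}. of_nat (degree p))"
      using finU by (intro sum.mono_neutral_cong_right) (auto split: if_splits)
    also have "\<dots> = (\<Sum>(p, j)\<in>primary_divisors g. of_nat (degree p))"
      using deg
      by (intro sum.reindex_bij_witness[of _ "\<lambda>(p, j). (j * degree p, p, j)" snd])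
        (auto simp: U_def primary_divisors_def primary_pairs_def)
    finally show ?thesis by simp
  qed
  have "of_nat k * (\<Sum>g\<in>monics k. F g) =
      (\<Sum>g\<in>monics k. (\<Sum>(p, j)\<in>primary_divisors g. of_nat (degree p)) * F g)"
  proof -
    have "(\<Sum>(p, j)\<in>primary_divisors g. of_nat (degree p)) = (of_nat k :: complex)"
      if "g \<in> monics k" for g :: "'a poly"
    proof -
      have "(\<Sum>(p, j)\<in>primary_divisors g. degree p) = k"
        using sum_primary_divisors[of g] that by (auto simp: monics_def)
      then have "of_nat (\<Sum>(p, j)\<in>primary_divisors g. degree p) = (of_nat k :: complex)" by simp
      then show ?thesis by (simp add: case_prod_unfold)
    qed
    then show ?thesis unfolding sum_distrib_left by (intro sum.cong) auto
  qed
  also have "\<dots> = (\<Sum>g\<in>monics k. \<Sum>(r, p, j)\<in>U. if p ^ j dvd g then of_nat (degree p) * F g else 0)"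
    by (intro sum.cong refl) (auto simp: PD sum_distrib_right intro!: sum.cong)
  also have "\<dots> = (\<Sum>(r, p, j)\<in>U. \<Sum>g\<in>monics k. if p ^ j dvd g then of_nat (degree p) * F g else 0)"
    by (subst sum.swap) (simp add: case_prod_unfold)
  also have "\<dots> = (\<Sum>(r, p, j)\<in>U. of_nat (degree p) * (F p ^ j * (\<Sum>g\<in>monics (k - r). F g)))"
  proof (intro sum.cong refl, clarify)
    fix r p j assume "(r, p, j) \<in> U"
    then have "(\<Sum>g | g \<in> monics k \<and> p ^ j dvd g. F g) = F p ^ j * (\<Sum>g\<in>monics (k - r). F g)"
      by (intro inner) (auto simp: U_def)
    then show "(\<Sum>g\<in>monics k. if p ^ j dvd g then of_nat (degree p) * F g else 0) =
        of_nat (degree p) * (F p ^ j * (\<Sum>g\<in>monics (k - r). F g))"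
      by (simp add: sum.inter_filter[symmetric] finite_monics flip: sum_distrib_left)
  qed
  also have "\<dots> = (\<Sum>r=1..k. primary_sum F r * (\<Sum>g\<in>monics (k - r). F g))"
    unfolding U_def by (subst sum.Sigma[symmetric])
      (auto simp: finite_primary_pairs primary_sum_def sum_distrib_right mult.assoc case_prod_unfold intro!: sum.cong)
  finally show ?thesis .
qed

text \<open>Here L = 1 / (1 - qT): subtracting \<open>?q\<close> times the recurrence for
  \<open>k\<close> from that for \<open>Suc k\<close> leaves only the last term.\<close>

lemma primary_sum_one:
  assumes "r \<ge> 1"
  shows "primary_sum (\<lambda>_::'a::{field,finite} poly. 1) r = of_nat (CARD('a) ^ r)"
proof -
  let ?S = "primary_sum (\<lambda>_::'a poly. 1)" and ?q = "of_nat CARD('a) :: complex"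
  have rec: "of_nat k * ?q ^ k = (\<Sum>r=1..k. ?S r * ?q ^ (k - r))" for k
    using primary_sum_recurrence[of "\<lambda>_::'a poly. 1" k] by (simp add: card_monics)
  obtain k where k: "r = Suc k" using assms by (cases r) auto
  have "of_nat (Suc k) * ?q ^ Suc k = (\<Sum>r=1..k. ?S r * ?q ^ (Suc k - r)) + ?S (Suc k)"
    using rec[of "Suc k"] by simp
  also have "(\<Sum>r=1..k. ?S r * ?q ^ (Suc k - r)) = ?q * (\<Sum>r=1..k. ?S r * ?q ^ (k - r))"
    by (auto simp: sum_distrib_left Suc_diff_le intro!: sum.cong)
  also have "\<dots> = ?q * (of_nat k * ?q ^ k)" by (simp add: rec)
  finally show ?thesis by (simp add: k algebra_simps)
qed

section \<open>Inverse roots and the growth of power sums\<close>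

text \<open>The constant term is 0, not the number of entries, as the series has to be a logarithmic
  derivative times X, up to sign.\<close>

definition power_sum_fps :: "complex list \<Rightarrow> complex fps" where
  "power_sum_fps ws = Abs_fps (\<lambda>r. if r = 0 then 0 else (\<Sum>w\<leftarrow>ws. w ^ r))"

text \<open>Logarithmic differentiation: the factor 1 - wX contributes -wX / (1 - wX), minus a
  geometric series.\<close>

lemma X_deriv_prod_linear_factors:
  "fps_X * fps_deriv (\<Prod>w\<leftarrow>ws. 1 - fps_const w * fps_X) =
    - power_sum_fps ws * (\<Prod>w\<leftarrow>ws. 1 - fps_const w * fps_X)"
proof (induction ws)
  case (Cons w ws)
  let ?P = "\<Prod>w\<leftarrow>ws. 1 - fps_const w * fps_X"
  have single: "power_sum_fps [w] * (1 - fps_const w * fps_X) = fps_const w * fps_X"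
  proof -
    have "T * (1 - c * x) = T - c * (x * T)" for T c x :: "complex fps"
      by (simp add: algebra_simps)
    then have "power_sum_fps [w] * (1 - fps_const w * fps_X) =
        power_sum_fps [w] - fps_const w * (fps_X * power_sum_fps [w])" .
    also have "\<dots> = fps_const w * fps_X"
    proof (rule fps_ext)
      fix k
      show "fps_nth (power_sum_fps [w] - fps_const w * (fps_X * power_sum_fps [w])) k = fps_nth (fps_const w * fps_X) k"
      proof (cases k)
        case (Suc j)
        then show ?thesis by (cases j) (simp_all add: power_sum_fps_def)
      qed (simp add: power_sum_fps_def)
    qed
    finally show ?thesis .
  qed
  have add: "power_sum_fps (w # ws) = power_sum_fps [w] + power_sum_fps ws"
    by (rule fps_ext) (simp add: power_sum_fps_def)
  have algebra: "x * (f * p' - c * p) = - (T + t) * (f * p)"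
    if "x * p' = - T * p" "t * f = c * x" for x f p p' c T t :: "complex fps"
  proof -
    have "x * (f * p' - c * p) = f * (x * p') - (c * x) * p" by (simp add: algebra_simps)
    also have "\<dots> = - (T + t) * (f * p)" unfolding that(1) that(2)[symmetric] by (simp add: algebra_simps)
    finally show ?thesis .
  qed
  have "fps_deriv ((1 - fps_const w * fps_X) * ?P) =
      (1 - fps_const w * fps_X) * fps_deriv ?P - fps_const w * ?P"
    by (simp add: fps_const_neg[symmetric] del: fps_const_neg)
  then have "fps_X * fps_deriv (\<Prod>w\<leftarrow>w # ws. 1 - fps_const w * fps_X) =
      - (power_sum_fps ws + power_sum_fps [w]) * ((1 - fps_const w * fps_X) * ?P)"
    using algebra[OF Cons.IH single] by simp
  then show ?case by (simp add: add add.commute)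
qed (simp add: power_sum_fps_def fps_eq_iff)

text \<open>The \<open>A k\<close> are the coefficients of a polynomial \<open>a\<close> with
  constant term 1, hence of a product of factors 1 - wX. Both the series of the \<open>S r\<close>
  and minus the power sums of the \<open>w\<close> give X a' when multiplied by \<open>a\<close>;
  cancel \<open>a\<close>.\<close>

lemma newton_identities_power_sums:
  fixes A S :: "nat \<Rightarrow> complex"
  assumes A: "A 0 = 1" "\<And>k. k \<ge> n \<Longrightarrow> A k = 0"
    and rec: "\<And>k. of_nat k * A k = (\<Sum>r=1..k. S r * A (k - r))"
  shows "\<exists>ws. length ws < n \<and> (\<forall>r\<ge>1. S r = - (\<Sum>w\<leftarrow>ws. w ^ r))"
proof -
  have n: "n > 0" using A by (metis less_numeral_extra(3) not_gr_zero le_refl one_neq_zero)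
  define a where "a = Poly (map A [0..<n])"
  have coeff_a: "coeff a k = A k" for k
    using A(2)[of k] by (auto simp: a_def nth_default_def)
  have a0: "a \<noteq> 0" "poly a 0 = 1" using coeff_a[of 0] A(1) by (auto simp: poly_0_coeff_0)
  obtain M where M: "size M = degree a" "a = Polynomial.smult (lead_coeff a) (\<Prod>x\<in>#M. [:- x, 1:])"
    using alg_closed_imp_factorization[OF a0(1)] by blast
  obtain zs where zs: "mset zs = M" by (metis ex_mset)
  define c where "c = lead_coeff a"
  have afac: "a = Polynomial.smult c (\<Prod>z\<leftarrow>zs. [:- z, 1:])"
    using M(2) unfolding c_def zs[symmetric] by (metis mset_map prod_mset_prod_list)
  have nz: "z \<noteq> 0" if "z \<in> set zs" for z
  proof
    assume "z = 0"
    then have "poly a 0 = 0"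
      using that by (auto simp: afac poly_prod_list prod_list_zero_iff)
    then show False using a0 by simp
  qed
  define ws where "ws = map inverse zs"
  \<comment> \<open>No root is zero, so X - z is a constant multiple of 1 - X / z; the constants
    collect in \<open>e\<close>.\<close>
  have "\<exists>e. (\<Prod>z\<leftarrow>zs. [:- z, 1:]) = Polynomial.smult e (\<Prod>w\<leftarrow>map inverse zs. [:1, - w:])"
    using nz
  proof (induction zs)
    case (Cons z zs)
    then obtain e where "(\<Prod>z\<leftarrow>zs. [:- z, 1:]) = Polynomial.smult e (\<Prod>w\<leftarrow>map inverse zs. [:1, - w:])" by auto
    moreover have "[:- z, 1:] = Polynomial.smult (- z) [:1, - inverse z:]" using Cons.prems by simp
    ultimately show ?case
      by (intro exI[of _ "- z * e"]) (simp only: list.map prod_list.Cons mult_smult_left mult_smult_right smult_smult mult.commute)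
  qed (auto intro: exI[of _ 1])
  then obtain e where "a = Polynomial.smult (c * e) (\<Prod>w\<leftarrow>ws. [:1, - w:])"
    by (auto simp: afac ws_def)
  \<comment> \<open>The value 1 at 0 on both sides forces \<open>c * e = 1\<close>.\<close>
  moreover have "poly (\<Prod>w\<leftarrow>ws. [:1, - w:]) 0 = 1" by (induction ws) auto
  ultimately have afac': "a = (\<Prod>w\<leftarrow>ws. [:1, - w:])" using a0(2) by auto
  have "fps_of_poly [:1, - w:] = 1 - fps_const w * fps_X" for w :: complex
    by (simp add: fps_of_poly_pCons mult.commute)
  then have fa: "fps_of_poly a = (\<Prod>w\<leftarrow>ws. 1 - fps_const w * fps_X)"
    unfolding afac' by (induction ws) (simp_all add: fps_of_poly_mult)
  define F where "F = Abs_fps (\<lambda>r. if r = 0 then 0 else S r)"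
  have "fps_X * fps_deriv (fps_of_poly a) = F * fps_of_poly a"
  proof (rule fps_ext)
    fix k
    have "fps_nth (F * fps_of_poly a) k = (\<Sum>i=0..k. fps_nth F i * A (k - i))"
      by (simp add: fps_mult_nth coeff_a)
    also have "\<dots> = (\<Sum>i=1..k. S i * A (k - i))"
      by (intro sum.mono_neutral_cong_right) (auto simp: F_def)
    finally show "fps_nth (fps_X * fps_deriv (fps_of_poly a)) k = fps_nth (F * fps_of_poly a) k"
      using rec[of k] by (cases k) (auto simp: coeff_a)
  qed
  moreover have "fps_X * fps_deriv (fps_of_poly a) = - power_sum_fps ws * fps_of_poly a"
    using X_deriv_prod_linear_factors[of ws] by (simp add: fa)
  moreover have "fps_of_poly a \<noteq> 0" using a0 by simp
  ultimately have F: "F = - power_sum_fps ws" by (metis mult_right_cancel)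
  have "S r = - (\<Sum>w\<leftarrow>ws. w ^ r)" if "r \<ge> 1" for r
    using arg_cong[OF F, of "\<lambda>f. fps_nth f r"] that by (simp add: F_def power_sum_fps_def)
  moreover have "length ws < n"
  proof -
    have "length ws = degree a" using M zs by (simp add: ws_def flip: size_mset)
    also have "degree a \<le> n - 1" using A(2) by (intro degree_le) (auto simp: coeff_a)
    finally show ?thesis using n by simp
  qed
  ultimately show ?thesis by blast
qed

lemma sum_list_indicator:
  "(\<Sum>w\<leftarrow>ws. if w = v then c else (0::complex)) = of_nat (count_list ws v) * c"
  by (induction ws) (auto simp: algebra_simps)

text \<open>A combination of shifts of the power sums, given by the polynomial that vanishes at every
  other \<open>w\<close>, isolates the term of a single \<open>v\<close>.\<close>

lemma norm_le_of_power_sums_le: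
  fixes ws :: "complex list" and B C :: real
  assumes B: "B > 0" and C: "\<And>s. s \<ge> s0 \<Longrightarrow> cmod (\<Sum>w\<leftarrow>ws. w ^ s) \<le> C * B ^ s"
    and v: "v \<in> set ws"
  shows "cmod v \<le> B"
proof (rule ccontr)
  assume "\<not> cmod v \<le> B"
  then have big: "cmod v / B > 1" using B by simp
  define P where "P = (\<Prod>w\<in>set ws - {v}. [:- w, 1:])"
  have P0: "poly P w = 0" if "w \<in> set ws" "w \<noteq> v" for w
    using that by (auto simp: P_def poly_prod prod_zero_iff)
  have Pv: "poly P v \<noteq> 0" by (auto simp: P_def poly_prod)
  define a where "a = (\<lambda>s. \<Sum>w\<leftarrow>ws. w ^ s)"
  have shift: "(\<Sum>j\<le>degree P. coeff P j * a (s + j)) = of_nat (count_list ws v) * (v ^ s * poly P v)" for s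
  proof -
    have "(\<Sum>j\<le>degree P. coeff P j * (\<Sum>w\<leftarrow>us. w ^ (s + j))) = (\<Sum>w\<leftarrow>us. w ^ s * poly P w)" for us
      by (induction us)
        (simp_all add: poly_altdef sum_distrib_left sum.distrib algebra_simps power_add)
    then have "(\<Sum>j\<le>degree P. coeff P j * a (s + j)) = (\<Sum>w\<leftarrow>ws. w ^ s * poly P w)"
      by (simp add: a_def)
    also have "\<dots> = (\<Sum>w\<leftarrow>ws. if w = v then v ^ s * poly P v else 0)"
      using P0 by (intro arg_cong[of _ _ sum_list] map_cong refl) auto
    finally show ?thesis by (simp add: sum_list_indicator)
  qed
  define K where "K = of_nat (count_list ws v) * cmod (poly P v)"
  have "count_list ws v > 0" using v count_list_0_iff[of ws v] by simp
  then have K: "K > 0" using Pv by (simp add: K_def)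
  define C' where "C' = (\<Sum>j\<le>degree P. cmod (coeff P j) * C * B ^ j)"
  have bound: "K * cmod v ^ s \<le> C' * B ^ s" if s: "s \<ge> s0" for s
  proof -
    have "K * cmod v ^ s = cmod (\<Sum>j\<le>degree P. coeff P j * a (s + j))"
      by (simp add: shift K_def norm_mult norm_power)
    also have "\<dots> \<le> (\<Sum>j\<le>degree P. cmod (coeff P j) * cmod (a (s + j)))"
      by (rule order_trans[OF norm_sum]) (simp add: norm_mult)
    also have "\<dots> \<le> (\<Sum>j\<le>degree P. cmod (coeff P j) * (C * B ^ (s + j)))"
      using C s by (intro sum_mono mult_left_mono) (auto simp: a_def)
    also have "\<dots> = C' * B ^ s"
      by (simp add: C'_def sum_distrib_left power_add mult_ac)
    finally show ?thesis .
  qed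
  obtain m where m: "C' / K < (cmod v / B) ^ m" using real_arch_pow[OF big] by blast
  define s where "s = max m s0"
  have "(cmod v / B) ^ m \<le> (cmod v / B) ^ s"
    using big by (intro power_increasing) (auto simp: s_def)
  with m have "C' / K < (cmod v / B) ^ s" by simp
  then have "C' * B ^ s < K * cmod v ^ s" using K B by (simp add: field_simps)
  then show False using bound[of s] by (simp add: s_def)
qed

section \<open>Stepanov's method\<close>

text \<open>Gaussian elimination: a zero row is dropped; otherwise the unknown of a pivot
  \<open>a0\<close> is eliminated from the other rows.\<close>

lemma exists_nontrivial_solution:
  fixes M :: "'k \<Rightarrow> 'i \<Rightarrow> 'c::field"
  assumes "finite B" "finite A" "card B < card A"
  shows "\<exists>c. (\<exists>a\<in>A. c a \<noteq> 0) \<and> (\<forall>b\<in>B. (\<Sum>a\<in>A. c a * M b a) = 0)"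
  using assms
proof (induction B arbitrary: A M rule: finite_induct)
  case empty
  then obtain a where "a \<in> A" by (metis card.empty card_gt_0_iff ex_in_conv)
  then show ?case by (intro exI[of _ "\<lambda>_. 1"]) auto
next
  case (insert b B)
  show ?case
  proof (cases "\<forall>a\<in>A. M b a = 0")
    case True
    have "card B < card A" using insert by simp
    then obtain c where "\<exists>a\<in>A. c a \<noteq> 0" "\<forall>b\<in>B. (\<Sum>a\<in>A. c a * M b a) = 0"
      using insert.IH[of A M] insert.prems by blast
    with True show ?thesis by (intro exI[of _ c]) auto
  next
    case False
    then obtain a0 where a0: "a0 \<in> A" "M b a0 \<noteq> 0" by blast
    define A' where "A' = A - {a0}"
    have A: "A = insert a0 A'" "a0 \<notin> A'" "finite A'" using a0 insert.prems by (auto simp: A'_def)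
    have "card B < card A'" using A insert by simp
    then obtain c where c: "\<exists>a\<in>A'. c a \<noteq> 0"
      "\<And>k. k \<in> B \<Longrightarrow> (\<Sum>a\<in>A'. c a * (M k a - M b a / M b a0 * M k a0)) = 0"
      using insert.IH[of A' "\<lambda>k a. M k a - M b a / M b a0 * M k a0"] A by blast
    define z where "z = - (\<Sum>a\<in>A'. c a * M b a) / M b a0"
    define c' where "c' = c(a0 := z)"
    have sum: "(\<Sum>a\<in>A. c' a * M k a) = z * M k a0 + (\<Sum>a\<in>A'. c a * M k a)" for k
      using A by (auto simp: c'_def intro!: sum.cong)
    have "(\<Sum>a\<in>A. c' a * M k a) = 0" if "k \<in> insert b B" for k
    proof (cases "k = b")
      case True
      then show ?thesis using a0 by (simp add: sum z_def)
    next
      case False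
      then have "(\<Sum>a\<in>A'. c a * M k a) = (\<Sum>a\<in>A'. c a * M b a / M b a0 * M k a0)"
        using c(2)[of k] that by (simp add: algebra_simps sum_subtractf)
      then show ?thesis by (simp add: sum z_def sum_distrib_right sum_divide_distrib)
    qed
    moreover have "\<exists>a\<in>A. c' a \<noteq> 0" using c(1) A by (auto simp: c'_def)
    ultimately show ?thesis by blast
  qed
qed

text \<open>Exactly one term with nonzero coefficient has the least order at \<open>a\<close>. In a
  vanishing sum, X - a would divide it once more than its order allows.\<close>

lemma sum_distinct_orders_nonzero:
  fixes P :: "'i \<Rightarrow> 'c::field poly"
  assumes "finite I" "\<exists>i\<in>I. c i \<noteq> 0" "\<And>i. i \<in> I \<Longrightarrow> P i \<noteq> 0"
    and inj: "inj_on (\<lambda>i. order a (P i)) I"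
  shows "(\<Sum>i\<in>I. Polynomial.smult (c i) (P i)) \<noteq> 0"
proof
  assume zero: "(\<Sum>i\<in>I. Polynomial.smult (c i) (P i)) = 0"
  define J where "J = {i \<in> I. c i \<noteq> 0}"
  have J: "finite J" "J \<noteq> {}" using assms(1,2) by (auto simp: J_def)
  define i0 where "i0 = arg_min_on (\<lambda>i. order a (P i)) J"
  have i0: "i0 \<in> J" "\<And>i. i \<in> J \<Longrightarrow> order a (P i0) \<le> order a (P i)"
    using arg_min_if_finite(1)[OF J] arg_min_least[OF J] by (auto simp: i0_def)
  define N where "N = Suc (order a (P i0))"
  have other: "[:- a, 1:] ^ N dvd Polynomial.smult (c i) (P i)" if "i \<in> J - {i0}" for i
  proof -
    have "order a (P i) \<noteq> order a (P i0)" using inj that i0(1) by (auto simp: inj_on_def J_def)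
    then have "N \<le> order a (P i)" using i0(2)[of i] that by (simp add: N_def)
    then show ?thesis using order_divides dvd_smult by blast
  qed
  have "0 = (\<Sum>i\<in>J. Polynomial.smult (c i) (P i))"
    unfolding zero[symmetric] using assms(1) by (intro sum.mono_neutral_right) (auto simp: J_def)
  also have "\<dots> = Polynomial.smult (c i0) (P i0) + (\<Sum>i\<in>J - {i0}. Polynomial.smult (c i) (P i))"
    using J i0(1) by (simp add: sum.remove)
  finally have eq: "Polynomial.smult (c i0) (P i0) = - (\<Sum>i\<in>J - {i0}. Polynomial.smult (c i) (P i))"
    by (simp add: eq_neg_iff_add_eq_0)
  have "[:- a, 1:] ^ N dvd Polynomial.smult (c i0) (P i0)"
    unfolding eq dvd_minus_iff by (intro dvd_sum other)
  then have "[:- a, 1:] ^ N dvd P i0" 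
    by (rule dvd_smult_cancel) (use i0(1) in \<open>simp add: J_def\<close>)
  then show False using i0(1) assms(3) order_divides[of a N "P i0"] by (auto simp: J_def N_def)
qed

section \<open>Taylor expansion along G\<close>

text \<open>
  This is \<open>P(X + G t)\<close> as a polynomial in \<open>t\<close>, so the coefficient of \<open>t\<^sup>j\<close> is the \<open>j\<close>-th Hasse derivative
  of \<open>P\<close> times \<open>G\<^sup>j\<close>. With this factor, the coefficients for \<open>P G\<^sup>N\<close> stay divisible by \<open>G\<^sup>N\<close>.
\<close>

definition scaled_taylor :: "'c::field poly \<Rightarrow> 'c poly \<Rightarrow> 'c poly poly" where
  "scaled_taylor G P = poly (map_poly (\<lambda>c. [:[:c:]:]) P) [:[:0, 1:], G:]"

lemma const_const_hom: "comm_ring_hom (\<lambda>c::'c::field. [:[:c:]:])"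
  by unfold_locales auto

lemma scaled_taylor_0 [simp]: "scaled_taylor G 0 = 0"
  by (simp add: scaled_taylor_def)

lemma scaled_taylor_pCons:
  "scaled_taylor G (pCons c P) = [:[:c:]:] + [:[:0, 1:], G:] * scaled_taylor G P"
  by (simp only: scaled_taylor_def Polynomial.map_poly_pCons pCons_0_0 poly_pCons)

lemma scaled_taylor_1 [simp]: "scaled_taylor G 1 = 1"
  using scaled_taylor_pCons[of G 1 0] by simp

lemma scaled_taylor_add: "scaled_taylor G (P + Q) = scaled_taylor G P + scaled_taylor G Q"
  and scaled_taylor_mult: "scaled_taylor G (P * Q) = scaled_taylor G P * scaled_taylor G Q"
proof -
  interpret map_poly_comm_ring_hom "\<lambda>c::'a. [:[:c:]:]"
    using const_const_hom unfolding map_poly_comm_ring_hom_def .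
  show "scaled_taylor G (P + Q) = scaled_taylor G P + scaled_taylor G Q"
    by (simp only: scaled_taylor_def hom_add poly_add)
  show "scaled_taylor G (P * Q) = scaled_taylor G P * scaled_taylor G Q"
    by (simp only: scaled_taylor_def hom_mult poly_mult)
qed

lemma scaled_taylor_power: "scaled_taylor G (P ^ k) = scaled_taylor G P ^ k"
  by (induction k) (simp_all add: scaled_taylor_mult)

lemma scaled_taylor_smult: "scaled_taylor G (Polynomial.smult c P) = [:[:c:]:] * scaled_taylor G P"
  using scaled_taylor_mult[of G "[:c:]" P] scaled_taylor_pCons[of G c 0] by simp

lemma scaled_taylor_sum: "scaled_taylor G (\<Sum>i\<in>I. f i) = (\<Sum>i\<in>I. scaled_taylor G (f i))"
  by (induction I rule: infinite_finite_induct) (simp_all add: scaled_taylor_add)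

lemma map_poly_eval_scaled_taylor:
  "map_poly (\<lambda>p. poly p x) (scaled_taylor G P) = pcompose P [:x, poly G x:]"
proof (induction P)
  case (pCons c P)
  interpret map_poly_comm_ring_hom "\<lambda>p::'a poly. poly p x"
    by unfold_locales auto
  show ?case
    by (simp only: scaled_taylor_pCons hom_add hom_mult pcompose_pCons pCons.IH
        Polynomial.map_poly_pCons poly_0 map_poly_0 poly_pCons) simp
qed simp

text \<open>With g = G(x), the hypothesis says that t^l divides P(x + gt); as g is nonzero, t can be
  replaced by (X - x) / g.\<close>

lemma dvd_of_scaled_taylor_coeffs:
  fixes G P :: "'c::field poly"
  assumes "poly G x \<noteq> 0" "\<And>j. j < l \<Longrightarrow> poly (coeff (scaled_taylor G P) j) x = 0"
  shows "[:- x, 1:] ^ l dvd P"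
proof -
  define g where "g = poly G x"
  have "coeff (pcompose P [:x, g:]) j = 0" if "j < l" for j
    using assms(2)[OF that] unfolding g_def map_poly_eval_scaled_taylor[symmetric]
    by (simp add: coeff_map_poly)
  then have "monom 1 l dvd pcompose P [:x, g:]" by (simp add: monom_1_dvd_iff')
  then obtain V where V: "pcompose P [:x, g:] = monom 1 l * V" by (elim dvdE)
  let ?s = "[:- x / g, 1 / g:]"
  have "P = pcompose (pcompose P [:x, g:]) ?s"
    using assms(1) by (simp add: pcompose_assoc[symmetric] pcompose_pCons g_def del: pCons_one)
  also have "\<dots> = ?s ^ l * pcompose V ?s"
    by (simp add: V pcompose_mult monom_altdef pcompose_smult pcompose_hom.hom_power pcompose_pCons)
  also have "?s ^ l = Polynomial.smult ((1 / g) ^ l) ([:- x, 1:] ^ l)"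
    by (simp add: smult_power[symmetric])
  finally have "P = [:- x, 1:] ^ l * Polynomial.smult ((1 / g) ^ l) (pcompose V ?s)"
    by (simp only: mult_smult_left mult_smult_right)
  then show ?thesis by (metis dvd_triv_left)
qed

text \<open>A degree filtration on polynomials in X and t in which t counts as degree
  \<open>- D\<close>.\<close>

definition weight_le :: "nat \<Rightarrow> nat \<Rightarrow> 'c::field poly poly \<Rightarrow> bool" where
  "weight_le D e U \<longleftrightarrow> (\<forall>j. degree (coeff U j) \<le> e + j * D)"

lemma weight_le_mult:
  assumes "weight_le D e U" "weight_le D e' V"
  shows "weight_le D (e + e') (U * V)"
  unfolding weight_le_def coeff_mult
proof (intro allI degree_sum_le finite_atMost)
  fix j i :: nat assume i: "i \<in> {..j}"
  have "degree (coeff U i * coeff V (j - i)) \<le> degree (coeff U i) + degree (coeff V (j - i))"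
    by (rule degree_mult_le)
  also have "\<dots> \<le> (e + i * D) + (e' + (j - i) * D)"
    using assms by (intro add_mono) (auto simp: weight_le_def)
  also have "\<dots> = e + e' + j * D"
    using i by (simp flip: distrib_right)
  finally show "degree (coeff U i * coeff V (j - i)) \<le> e + e' + j * D" .
qed

lemma weight_le_power:
  assumes "weight_le D 0 U"
  shows "weight_le D 0 (U ^ k)"
proof (induction k)
  case 0
  show ?case by (auto simp: weight_le_def coeff_1)
next
  case (Suc k)
  then show ?case using weight_le_mult[OF assms Suc] by simp
qed

text \<open>In Horner's rule X becomes X + Gt, whose weight is at most 1, as t offsets the degree of
  \<open>G\<close>.\<close>

lemma weight_le_scaled_taylor:
  "weight_le (degree G) (degree P) (scaled_taylor G P)"
proof (induction P)
  case (pCons c P)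
  have "weight_le (degree G) 1 [:[:0, 1:], G:]"
    by (auto simp: weight_le_def coeff_pCons split: nat.splits)
  from weight_le_mult[OF this pCons.IH]
  have "weight_le (degree G) (1 + degree P) ([:[:0, 1:], G:] * scaled_taylor G P)" .
  moreover have "degree (coeff [:[:c:]:] j) = 0" for j
    by (auto simp: coeff_pCons split: nat.splits)
  ultimately have w: "weight_le (degree G) (1 + degree P) (scaled_taylor G (pCons c P))"
    unfolding scaled_taylor_pCons weight_le_def coeff_add by (metis degree_add_le le0)
  show ?case
  \<comment> \<open>\<open>P = 0\<close> is separate, as then \<open>pCons c P\<close> has degree 0
    and not \<open>1 + degree P\<close>.\<close>
  proof (cases "P = 0")
    case True
    then show ?thesis
      by (auto simp: weight_le_def scaled_taylor_pCons coeff_pCons split: nat.splits)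
  qed (use w in simp)
qed (simp add: weight_le_def)

text \<open>G(X + Gt) is congruent to G modulo Gt, hence divisible by \<open>G\<close>, and this
  division lowers the weight from \<open>degree G\<close> to 0.\<close>

lemma scaled_taylor_self_factor:
  fixes G :: "'c::field poly"
  assumes "G \<noteq> 0"
  shows "\<exists>Y. scaled_taylor G G = [:G:] * Y \<and> weight_le (degree G) 0 Y"
proof -
  have "\<exists>Z. scaled_taylor G P = [:P:] + [:0, G:] * Z" for P
  proof (induction P)
    case (pCons c P)
    then obtain Z where Z: "scaled_taylor G P = [:P:] + [:0, G:] * Z" by blast
    have "[:[:c:]:] + [:[:0, 1:], G:] * ([:P:] + [:0, G:] * Z) =
        [:pCons c P:] + [:0, G:] * ([:P:] + [:[:0, 1:], G:] * Z)"
      by (simp add: algebra_simps)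
    then show ?case unfolding scaled_taylor_pCons Z by blast
  qed auto
  then obtain Z where Z: "scaled_taylor G G = [:G:] + [:0, G:] * Z" by blast
  then have Y: "scaled_taylor G G = [:G:] * pCons 1 Z" by simp
  have "degree (coeff Z j) \<le> Suc j * degree G" for j
  proof (cases "coeff Z j = 0")
    case False
    have "coeff (scaled_taylor G G) (Suc j) = G * coeff Z j" by (simp add: Z)
    then have "degree (coeff (scaled_taylor G G) (Suc j)) = degree G + degree (coeff Z j)"
      using False assms by (simp add: degree_mult_eq)
    then show ?thesis using weight_le_scaled_taylor[of G G] by (auto simp: weight_le_def dest: spec[of _ "Suc j"])
  qed simp
  then have "weight_le (degree G) 0 (pCons 1 Z)"
    by (auto simp: weight_le_def coeff_pCons split: nat.splits)
  with Y show ?thesis by blast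
qed

text \<open>Division with remainder by \<open>M * E + 1\<close>, the later \<open>R\<close>, and
  then by \<open>E\<close> recovers the digits.\<close>

lemma inj_on_mixed_radix:
  fixes E M :: nat
  shows "inj_on (\<lambda>(i, k, u). i * (M * E + 1) + (u + k * E)) ({..<J} \<times> {..<M} \<times> {..<E})"
proof (rule inj_onI)
  have div: "(s + i * N) div N = i" "(s + i * N) mod N = s" if "s < N" for s i N :: nat
    using that by auto
  have small: "u + k * E < M * E + 1" if "k < M" "u < E" for k u
  proof -
    have "u + k * E < Suc k * E" using that by simp
    also have "\<dots> \<le> M * E" using that by (intro mult_le_mono) auto
    finally show ?thesis by simp
  qed
  fix x y
  assume x: "x \<in> {..<J} \<times> {..<M} \<times> {..<E}" and y: "y \<in> {..<J} \<times> {..<M} \<times> {..<E}"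
    and xy: "(case x of (i, k, u) \<Rightarrow> i * (M * E + 1) + (u + k * E)) =
      (case y of (i, k, u) \<Rightarrow> i * (M * E + 1) + (u + k * E))"
  obtain i k u where x': "x = (i, k, u)" by (cases x)
  obtain i' k' u' where y': "y = (i', k', u')" by (cases y)
  have lt: "k < M" "u < E" "k' < M" "u' < E" using x y by (auto simp: x' y')
  have eq: "(u + k * E) + i * (M * E + 1) = (u' + k' * E) + i' * (M * E + 1)"
    using xy by (simp only: x' y' prod.case add.commute)
  have "i = i'" by (metis div(1) eq small lt)
  moreover have eq2: "u + k * E = u' + k' * E" by (metis div(2) eq small lt)
  moreover have "k = k'" by (metis div(1) eq2 lt(2,4))
  moreover have "u = u'" by (metis div(2) eq2 lt(2,4))
  ultimately show "x = y" by (simp add: x' y')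
qed

lemma finite_power_fixed_points:
  assumes "R > 1"
  shows "finite {x::'c::field. x ^ R = x}"
proof -
  have "coeff (monom 1 R - [:0, 1::'c:]) R = 1" using assms by (cases R) (auto simp: coeff_pCons split: nat.splits)
  then have "monom 1 R - [:0, 1::'c:] \<noteq> 0" by (metis coeff_0 zero_neq_one)
  moreover have "{x::'c. x ^ R = x} = {x. poly (monom 1 R - [:0, 1:]) x = 0}"
    by (auto simp: poly_monom)
  ultimately show ?thesis by (metis poly_roots_finite)
qed

text \<open>
  The auxiliary polynomial is a combination of the \<open>(X - a)\<^bsup>u + iR\<^esup> G\<^bsup>kE\<^esup>\<close> with \<open>i < J\<close>, \<open>k < M\<close>, \<open>u < E\<close>.
  Their orders \<open>u + kE + iR\<close> at the simple root \<open>a\<close> of \<open>G\<close> are pairwise distinct, so that a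
  nontrivial combination is nonzero. On the points in question \<open>(X - a)\<^sup>R\<close> may be replaced by \<open>X - a\<close>
  and \<open>G\<^sup>E\<close> by \<open>c\<close>, which makes vanishing to order \<open>l\<close> a linear system with few equations.
\<close>

theorem stepanov_bound:
  fixes G :: "'c::field poly" and a c :: 'c
  assumes dream: "\<And>U V :: 'c poly poly. (U + V) ^ R = U ^ R + V ^ R"
    and R: "R = M * E + 1" "M > 0" "E > 0"
    and G: "order a G = 1" "G \<noteq> 0" and a: "a ^ R = a" and c: "c \<noteq> 0"
    and l: "l \<le> R" "l * (J + E + l * degree G) < J * M * E"
  shows "card {x. x ^ R = x \<and> poly G x ^ E = c} * l \<le> E + J * R + M * E * degree G"
proof (cases "l = 0")
  case False
  define Pts where "Pts = {x. x ^ R = x \<and> poly G x ^ E = c}"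
  define D where "D = degree G"
  define L where "L = [:- a, 1:]"
  define I where "I = {..<J} \<times> {..<M} \<times> {..<E}"
  \<comment> \<open>Each of the \<open>l\<close> orders of vanishing costs \<open>W\<close> linear
    equations, since \<open>W\<close> exceeds the degrees of all \<open>q t j\<close> that
    occur.\<close>
  define W where "W = J + E + l * D"
  obtain Y where Y: "scaled_taylor G G = [:G:] * Y" "weight_le D 0 Y"
    using scaled_taylor_self_factor[OF G(2)] by (auto simp: D_def)
  \<comment> \<open>The t^j coefficient of the expansion of \<open>L ^ u * G ^ (k * E)\<close>,
    divided by \<open>G ^ (k * E)\<close>.\<close>
  define b where "b = (\<lambda>(i::nat, k, u) j. coeff (scaled_taylor G (L ^ u) * Y ^ (k * E)) j)"
  \<comment> \<open>The low degree substitute for the coefficients of \<open>P (i, k, u)\<close>: it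
    agrees with them at the points in question, where \<open>L ^ R = L\<close> and
    \<open>G ^ E = c\<close>.\<close>
  define q where "q = (\<lambda>(i, k, u) j. L ^ i * Polynomial.smult (c ^ k) (b (i, k, u) j))"
  define P where "P = (\<lambda>(i, k, u). L ^ (i * R) * (L ^ u * G ^ (k * E)))"
  have degb: "degree (b (i, k, u) j) \<le> u + j * D" for i k u j
  proof -
    have "degree (L ^ u) \<le> u" using degree_power_le[of L u] by (simp add: L_def)
    moreover have "weight_le D (degree (L ^ u) + 0) (scaled_taylor G (L ^ u) * Y ^ (k * E))"
      by (intro weight_le_mult weight_le_power Y) (simp add: D_def weight_le_scaled_taylor)
    ultimately have "degree (coeff (scaled_taylor G (L ^ u) * Y ^ (k * E)) j) \<le> u + 0 + j * D"
      unfolding weight_le_def by (meson add_right_mono le_trans)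
    then show ?thesis by (simp add: b_def)
  qed
  have degq: "degree (q t j) < W" if "t \<in> I" "j < l" for t j
  proof -
    obtain i k u where t: "t = (i, k, u)" by (cases t)
    have "degree (q t j) \<le> degree (L ^ i) + degree (Polynomial.smult (c ^ k) (b (i, k, u) j))"
      unfolding q_def t by (simp only: prod.case) (rule degree_mult_le)
    also have "\<dots> \<le> i + (u + j * D)"
      using degree_power_le[of L i] degb by (intro add_mono) (auto simp: L_def intro: order_trans[OF degree_smult_le])
    also have "\<dots> < J + (E + l * D)"
      using that t by (intro add_strict_mono add_less_le_mono mult_right_mono) (auto simp: I_def)
    finally show ?thesis by (simp add: W_def)
  qed
  have "finite I" "card I = J * M * E" by (simp_all add: I_def)
  moreover have "card ({..<l} \<times> {..<W}) < J * M * E" using l(2) by (simp add: W_def D_def)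
  ultimately obtain z where z: "\<exists>t\<in>I. z t \<noteq> 0"
    "\<And>j m. j < l \<Longrightarrow> m < W \<Longrightarrow> (\<Sum>t\<in>I. z t * coeff (q t j) m) = 0"
    using exists_nontrivial_solution[of "{..<l} \<times> {..<W}" I "\<lambda>(j, m) t. coeff (q t j) m"] by fastforce
  define F where "F = (\<Sum>t\<in>I. Polynomial.smult (z t) (P t))"
  have q0: "(\<Sum>t\<in>I. Polynomial.smult (z t) (q t j)) = 0" if j: "j < l" for j
  proof (rule poly_eqI)
    fix m
    show "coeff (\<Sum>t\<in>I. Polynomial.smult (z t) (q t j)) m = coeff 0 m"
    proof (cases "m < W")
      case True
      then show ?thesis using z(2)[OF j True] by (simp add: coeff_sum)
    next
      case False
      then have "coeff (q t j) m = 0" if "t \<in> I" for t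
        using degq[OF that j] by (intro coeff_eq_0) simp
      then show ?thesis by (simp add: coeff_sum)
    qed
  qed
  have L0: "L \<noteq> 0" by (simp add: L_def)
  have P0: "P t \<noteq> 0" for t using L0 G(2) by (cases t) (simp add: P_def)
  have orderP: "order a (P (i, k, u)) = i * R + (u + k * E)" for i k u
  proof -
    have "order a (G ^ m) = m" for m
      by (induction m) (simp_all add: order_mult G del: pCons_one)
    moreover have "order a (L ^ m) = m" for m by (simp add: L_def order_power_n_n del: pCons_one)
    moreover have "L ^ (i * R) * (L ^ u * G ^ (k * E)) \<noteq> 0" "L ^ u * G ^ (k * E) \<noteq> 0"
      using L0 G(2) by auto
    ultimately show ?thesis by (simp add: P_def order_mult)
  qed
  have "inj_on (\<lambda>t. order a (P t)) I"
    using inj_on_mixed_radix[of M E J] unfolding I_def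
    by (rule inj_on_cong[THEN iffD1, rotated]) (auto simp: orderP R(1))
  then have F0: "F \<noteq> 0"
    unfolding F_def using z(1) P0 \<open>finite I\<close> by (intro sum_distinct_orders_nonzero) auto
  have degF: "degree F \<le> E + J * R + M * E * D"
    unfolding F_def
  proof (intro degree_sum_le[OF \<open>finite I\<close>] order_trans[OF degree_smult_le])
    fix t assume "t \<in> I"
    then obtain i k u where t: "t = (i, k, u)" "i < J" "k < M" "u < E" by (auto simp: I_def)
    have "degree (P t) \<le> degree (L ^ (i * R)) + (degree (L ^ u) + degree (G ^ (k * E)))"
      unfolding P_def t prod.case by (intro order_trans[OF degree_mult_le] add_mono degree_mult_le order_refl)
    also have "\<dots> \<le> i * R + (u + D * (k * E))"
      using degree_power_le[of L] degree_power_le[of G "k * E"]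
      by (intro add_mono) (simp_all add: L_def D_def del: pCons_one)
    also have "\<dots> \<le> J * R + (E + D * (M * E))"
      using t by (intro add_mono mult_le_mono) auto
    finally show "degree (P t) \<le> E + J * R + M * E * D" by (simp add: ac_simps)
  qed
  \<comment> \<open>By additivity of the R-th power, the expansion of \<open>L ^ (i * R)\<close> is
    constant modulo t^R, so below order \<open>l\<close> this factor passes through
    unchanged.\<close>
  have coeffP: "coeff (scaled_taylor G (P (i, k, u))) j = L ^ (i * R) * (G ^ (k * E) * b (i, k, u) j)"
    if "j < l" for i k u j
  proof -
    have "scaled_taylor G L = [:L:] + [:0, G:]"
      by (simp add: L_def scaled_taylor_pCons)
    moreover have power0: "[:0, G:] ^ R = monom (G ^ R) R"
      using monom_power[of G 1 R] by (simp add: monom_altdef)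
    ultimately have "scaled_taylor G L ^ R = [:L ^ R:] + monom (G ^ R) R"
      by (simp only: dream poly_const_pow power0)
    then have "\<exists>V. scaled_taylor G L ^ (i * R) = [:L ^ (i * R):] + monom 1 R * V"
    proof (induction i)
      case 0
      show ?case by (intro exI[of _ 0]) simp
    next
      case (Suc i)
      then obtain V where V: "scaled_taylor G L ^ (i * R) = [:L ^ (i * R):] + monom 1 R * V" by blast
      have m: "monom (G ^ R) R = monom 1 R * [:G ^ R:]" by (simp add: smult_monom)
      have "scaled_taylor G L ^ (Suc i * R) = ([:L ^ R:] + monom 1 R * [:G ^ R:]) * ([:L ^ (i * R):] + monom 1 R * V)"
        using Suc.prems V m by (simp add: power_add)
      also have "\<dots> = [:L ^ R:] * [:L ^ (i * R):] + monom 1 R * ([:G ^ R:] * ([:L ^ (i * R):] + monom 1 R * V) + [:L ^ R:] * V)"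
        by (simp only: algebra_simps)
      also have "[:L ^ R:] * [:L ^ (i * R):] = [:L ^ (Suc i * R):]" by (simp add: power_add)
      finally show ?case by blast
    qed
    then obtain V where V: "scaled_taylor G L ^ (i * R) = [:L ^ (i * R):] + monom 1 R * V" by blast
    define B where "B = scaled_taylor G (L ^ u) * Y ^ (k * E)"
    have "scaled_taylor G (P (i, k, u)) = ([:L ^ (i * R):] + monom 1 R * V) * ([:G ^ (k * E):] * B)"
      unfolding V[symmetric]
      by (simp only: P_def prod.case scaled_taylor_mult scaled_taylor_power Y(1) B_def
          power_mult_distrib poly_const_pow ac_simps)
    also have "\<dots> = [:L ^ (i * R) * G ^ (k * E):] * B + monom 1 R * (V * ([:G ^ (k * E):] * B))"
      by (simp add: algebra_simps)
    finally show ?thesis using that l(1) by (simp add: coeff_monom_mult b_def B_def)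
  qed
  have root: "l \<le> order x F" if x: "x \<in> Pts" for x
  proof -
    have xR: "x ^ R = x" and xG: "poly G x ^ E = c" using x by (auto simp: Pts_def)
    have "(x - a + a) ^ R = (x - a) ^ R + a ^ R"
      using dream[of "[:[:x - a:]:]" "[:[:a:]:]"] by (simp add: poly_const_pow)
    then have xa: "(x - a) ^ R = x - a" using xR a by (metis add_diff_cancel_right' diff_add_cancel)
    have gx: "poly G x \<noteq> 0" using xG c R(3) by auto
    have "poly (coeff (scaled_taylor G F) j) x = 0" if j: "j < l" for j
    proof -
      have "poly (coeff (scaled_taylor G (P t)) j) x = poly (q t j) x" for t
      proof -
        obtain i k u where t: "t = (i, k, u)" by (cases t)
        have "poly (L ^ (i * R)) x = poly (L ^ i) x"
          by (simp add: L_def mult.commute[of i] power_mult xa)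
        moreover have "poly (G ^ (k * E)) x = c ^ k"
          by (simp add: mult.commute[of k] power_mult xG)
        ultimately show ?thesis unfolding t coeffP[OF j] by (simp add: q_def)
      qed
      then have "poly (coeff (scaled_taylor G F) j) x = poly (\<Sum>t\<in>I. Polynomial.smult (z t) (q t j)) x"
        by (simp add: F_def scaled_taylor_sum scaled_taylor_smult coeff_sum poly_sum)
      then show ?thesis using q0[OF j] by simp
    qed
    then have "[:- x, 1:] ^ l dvd F" by (rule dvd_of_scaled_taylor_coeffs[OF gx])
    then show ?thesis using F0 order_divides by blast
  qed
  have "Pts \<subseteq> {x. poly F x = 0}"
    using root False F0 by (force simp: order_root)
  then have "card Pts * l \<le> (\<Sum>x | poly F x = 0. order x F)"
    using root sum_bounded_below[of Pts l "\<lambda>x. order x F"] sum_mono2[of "{x. poly F x = 0}" Pts "\<lambda>x. order x F"]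
      poly_roots_finite[OF F0] by fastforce
  also have "\<dots> \<le> degree F" using F0 by (rule sum_order_le_degree)
  finally show ?thesis using degF by (simp add: Pts_def D_def)
qed simp

section \<open>Frobenius orbits\<close>

lemma finite_field_power_card:
  fixes x :: "'a::{field,finite}"
  shows "x ^ CARD('a) = x"
proof (cases "x = 0")
  case False
  let ?S = "- {0::'a}"
  have "insert 0 ?S = UNIV" by auto
  then have card: "CARD('a) = Suc (card ?S)"
    using card_insert_disjoint[of ?S 0] by (simp only: finite) simp
  have "(\<Prod>y\<in>?S. y) = (\<Prod>y\<in>?S. x * y)"
    using False by (intro prod.reindex_bij_witness[of _ "\<lambda>y. x * y" "\<lambda>y. y / x"]) auto
  also have "\<dots> = x ^ card ?S * (\<Prod>y\<in>?S. y)" by (simp add: prod.distrib)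
  finally have "x ^ card ?S = 1" by simp
  then show ?thesis by (simp add: card)
qed (simp add: card_gt_0_iff)

lemma coeff_linear_power: "coeff ([:1, 1::'a::field:] ^ q) i = of_nat (q choose i)"
proof -
  have "[:1, 1::'a:] = monom 1 1 + 1" by (simp add: monom_altdef one_pCons del: pCons_one)
  then have "[:1, 1::'a:] ^ q = (\<Sum>k\<le>q. of_nat (q choose k) * monom 1 k)"
    by (simp add: binomial_ring monom_power)
  also have "coeff \<dots> i = (\<Sum>k\<le>q. if i = k then of_nat (q choose k) else 0)"
    unfolding coeff_sum by (intro sum.cong refl) (simp add: of_nat_poly smult_monom)
  also have "\<dots> = of_nat (q choose i)" by (simp add: binomial_eq_0)
  finally show ?thesis .
qed

text \<open>
  The polynomial \<open>(X + 1)\<^sup>q - X\<^sup>q - 1\<close> has degree less than \<open>q\<close> and vanishes on the whole field. This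
  gives the additivity of the \<open>q\<close>-th power without knowing that \<open>q\<close> is a prime power.
\<close>

lemma choose_card_eq_0:
  assumes i: "0 < i" "i < CARD('a::{field,finite})"
  shows "of_nat (CARD('a) choose i) = (0::'a)"
proof -
  define q where "q = CARD('a)"
  define P where "P = [:1, 1::'a:] ^ q - monom 1 q - 1"
  have q: "q > 0" by (simp add: q_def card_gt_0_iff)
  have coeffP: "coeff P k = of_nat (q choose k) - (if k = q then 1 else 0) - (if k = 0 then 1 else 0)" for k
    by (auto simp: P_def coeff_linear_power coeff_1 simp del: pCons_one)
  have "P = 0"
  proof (rule ccontr)
    assume "P \<noteq> 0"
    have "degree P \<le> q - 1"
      using q by (intro degree_le) (auto simp: coeffP binomial_eq_0)
    moreover have "poly P x = 0" for x
      using finite_field_power_card[of x] finite_field_power_card[of "1 + x"]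
      by (simp add: P_def poly_monom q_def)
    then have "{x. poly P x = 0} = UNIV" by auto
    then have "q \<le> degree P" using card_poly_roots_bound[OF \<open>P \<noteq> 0\<close>] by (simp add: q_def)
    ultimately show False using q by simp
  qed
  then show ?thesis using coeffP[of i] i by (simp add: q_def)
qed

text \<open>Only the outer binomial terms survive. The semiring is general because the result serves
  both a field and its bivariate polynomials.\<close>

lemma additive_power:
  fixes x y :: "'r::comm_semiring_1"
  assumes "q > 0" "\<And>i. 0 < i \<Longrightarrow> i < q \<Longrightarrow> of_nat (q choose i) = (0::'r)"
  shows "(x + y) ^ (q ^ s) = x ^ (q ^ s) + y ^ (q ^ s)"
proof -
  have one: "(x + y) ^ q = x ^ q + y ^ q" for x y :: 'r
  proof -
    have "(x + y) ^ q = (\<Sum>k\<le>q. of_nat (q choose k) * x ^ k * y ^ (q - k))" by (rule binomial_ring)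
    also have "\<dots> = (\<Sum>k\<in>{0, q}. of_nat (q choose k) * x ^ k * y ^ (q - k))"
      using assms(2) by (intro sum.mono_neutral_right) auto
    finally show ?thesis using assms(1) by (simp add: add.commute)
  qed
  show ?thesis
  proof (induction s)
    case (Suc s)
    have "(x + y) ^ (q ^ Suc s) = ((x + y) ^ (q ^ s)) ^ q" by (simp add: mult.commute flip: power_mult)
    then show ?case by (simp add: Suc one mult.commute flip: power_mult)
  qed simp
qed

section \<open>Conjugates over the small field\<close>

text \<open>The target field may be infinite: besides the big field, it will be an algebraic
  closure.\<close>

locale finite_field_extension =
  fixes h :: "'a::{field,finite} \<Rightarrow> 'c::field" and q :: nat
  assumes hom: "field_hom h" and q_def: "q = CARD('a)"
begin

sublocale field_hom h by (rule hom)

sublocale mh: map_poly_inj_comm_ring_hom h ..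

lemma q_gt_1: "q > 1"
proof -
  have "card {0, 1::'a} \<le> CARD('a)" by (intro card_mono) auto
  then show ?thesis by (simp add: q_def)
qed

lemma q_power_gt_0: "q ^ s > 0"
  using q_gt_1 by simp

lemma choose_q: "0 < i \<Longrightarrow> i < q \<Longrightarrow> of_nat (q choose i) = (0::'c)"
  using choose_card_eq_0[of i, where ?'a = 'a] hom_of_nat[of "q choose i"] by (simp add: q_def)

lemma frobenius_add: "(x + y :: 'c) ^ (q ^ s) = x ^ (q ^ s) + y ^ (q ^ s)"
  using q_gt_1 by (intro additive_power choose_q) auto

lemma frobenius_add_poly_poly: "(U + V :: 'c poly poly) ^ (q ^ s) = U ^ (q ^ s) + V ^ (q ^ s)"
proof (rule additive_power)
  fix i assume i: "0 < i" "i < q"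
  have "of_nat (q choose i) = ([:[:of_nat (q choose i):]:] :: 'c poly poly)" by (simp only: of_nat_poly)
  then show "of_nat (q choose i) = (0 :: 'c poly poly)" using choose_q[OF i] by simp
qed (use q_gt_1 in auto)

lemma frobenius_hom: "field_hom (\<lambda>x::'c. x ^ (q ^ s))"
  using q_power_gt_0[of s]
  by unfold_locales (auto simp: frobenius_add power_mult_distrib)

lemma frobenius_diff: "(x - y :: 'c) ^ (q ^ s) = x ^ (q ^ s) - y ^ (q ^ s)"
  using frobenius_add[of "x - y" y s] by (simp add: eq_diff_eq)

lemma frobenius_inj: "(x::'c) ^ (q ^ s) = y ^ (q ^ s) \<longleftrightarrow> x = y"
  using frobenius_diff[of x y s] q_power_gt_0[of s] by auto

lemma hom_power_q: "h c ^ (q ^ s) = h c"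
proof (induction s)
  case (Suc s)
  have "h c ^ (q ^ Suc s) = (h c ^ (q ^ s)) ^ q" by (simp add: mult.commute flip: power_mult)
  also have "\<dots> = h (c ^ q)" by (simp add: Suc hom_power)
  finally show ?case using finite_field_power_card[of c] by (simp add: q_def)
qed simp

text \<open>X^q - X has at most \<open>q\<close> roots, and the \<open>q\<close> elements of the
  range of \<open>h\<close> are already roots.\<close>

lemma fixed_point_in_range:
  assumes "(y::'c) ^ q = y"
  shows "y \<in> range h"
proof -
  define P where "P = monom 1 q - [:0, 1::'c:]"
  have lead: "coeff P q = 1" using q_gt_1 by (cases q) (auto simp: P_def coeff_pCons split: nat.splits)
  then have P0: "P \<noteq> 0" by auto
  have "degree P \<le> q"
    using q_gt_1 by (intro degree_le) (auto simp: P_def coeff_pCons split: nat.splits)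
  then have "card {x. poly P x = 0} \<le> q" using card_poly_roots_bound[OF P0] by simp
  moreover have sub: "range h \<subseteq> {x. poly P x = 0}"
    using hom_power_q[of _ 1] by (auto simp: P_def poly_monom)
  moreover have "card (range h) = q" using card_image[OF inj_f] by (simp add: q_def)
  ultimately have "range h = {x. poly P x = 0}"
    using poly_roots_finite[OF P0] by (intro card_subset_eq) (auto dest: card_mono)
  then show ?thesis using assms by (auto simp: P_def poly_monom)
qed

text \<open>A nonzero \<open>m\<close> of least degree vanishing at \<open>x\<close> divides both
  \<open>p\<close> and \<open>g\<close>. As a nonunit divisor of the irreducible \<open>p\<close>,
  it is \<open>p\<close> up to a unit.\<close>

lemma irreducible_dvd_of_common_root:
  assumes p: "irreducible p" and x: "poly (map_poly h p) x = 0" "poly (map_poly h g) x = 0"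
  shows "p dvd g"
proof -
  define A where "A = (\<lambda>r. r \<noteq> 0 \<and> poly (map_poly h r) x = 0)"
  have p0: "p \<noteq> 0" using p by auto
  have "A p" using x p0 by (simp add: A_def)
  then obtain m where m: "A m" and least: "\<And>r. A r \<Longrightarrow> degree m \<le> degree r"
    by (metis arg_min_natI arg_min_nat_le)
  have dvd: "m dvd r" if r: "poly (map_poly h r) x = 0" for r
  proof -
    have "poly (map_poly h (r div m * m + r mod m)) x =
        poly (map_poly h (r div m)) x * poly (map_poly h m) x + poly (map_poly h (r mod m)) x"
      by (simp only: mh.hom_mult mh.hom_add poly_mult poly_add)
    then have "poly (map_poly h (r mod m)) x = 0"
      using r m by (simp add: A_def)
    then have "r mod m = 0"
      using least[of "r mod m"] degree_mod_less'[of m r] m by (force simp: A_def)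
    then show ?thesis by auto
  qed
  have "\<not> is_unit m"
  proof
    assume "is_unit m"
    then obtain c where "m = [:c:]" "c \<noteq> 0"
      by (metis degree_eq_zeroE is_unit_iff_degree not_is_unit_0 pCons_0_0)
    then show False using m by (simp add: A_def)
  qed
  moreover obtain c where c: "p = m * c" using dvd[OF x(1)] by (elim dvdE)
  ultimately have "is_unit c" using p by (metis irreducibleD)
  then show ?thesis using dvd[OF x(2)] c by (simp add: mult_unit_dvd_iff)
qed

lemma frobenius_root:
  assumes "poly (map_poly h p) x = 0"
  shows "poly (map_poly h p) (x ^ (q ^ s)) = 0"
proof -
  interpret F: field_hom "\<lambda>x::'c. x ^ (q ^ s)" by (rule frobenius_hom)
  have "map_poly (\<lambda>x. x ^ (q ^ s)) (map_poly h p) = map_poly h p"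
    by (intro poly_eqI) (simp add: coeff_map_poly hom_power_q q_power_gt_0 power_0_left)
  then show ?thesis using F.poly_map_poly[of "map_poly h p" x] assms q_power_gt_0[of s] by simp
qed

text \<open>The product \<open>H\<close> over the distinct conjugates of \<open>x\<close> is fixed
  by Frobenius, so it comes from a polynomial \<open>g\<close> over the small field. As
  \<open>g\<close> vanishes at \<open>x\<close>, \<open>p\<close> divides it; as all conjugates are
  roots of \<open>p\<close>, the degrees agree.\<close>

lemma frobenius_orbit:
  assumes p: "irreducible p" "lead_coeff p = 1" and x: "poly (map_poly h p) x = 0"
  shows "map_poly h p = (\<Prod>i<degree p. [:- (x ^ (q ^ i)), 1:])"
    and "x ^ (q ^ degree p) = x"
    and "inj_on (\<lambda>i. x ^ (q ^ i)) {..<degree p}"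
proof -
  define \<phi> where "\<phi> = (\<lambda>i. x ^ (q ^ i))"
  have \<phi>_add: "\<phi> (i + j) = \<phi> i ^ (q ^ j)" for i j by (simp add: \<phi>_def power_add power_mult)
  have p0: "p \<noteq> 0" using p by auto
  then have fin: "finite {y. poly (map_poly h p) y = 0}" by (intro poly_roots_finite) simp
  have roots: "poly (map_poly h p) (\<phi> i) = 0" for i using frobenius_root[OF x] by (simp add: \<phi>_def)
  have cancel: "\<phi> (j - i) = x" if "i \<le> j" "\<phi> i = \<phi> j" for i j
  proof -
    have "\<phi> (j - i) ^ (q ^ i) = x ^ (q ^ i)" using \<phi>_add[of "j - i" i] that by (simp add: \<phi>_def)
    then show ?thesis by (simp add: frobenius_inj)
  qed
  have "\<not> inj \<phi>"
  proof
    assume "inj \<phi>"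
    then have "infinite (range \<phi>)" by (simp add: finite_image_iff)
    then show False using fin roots by (metis (mono_tags, lifting) finite_subset image_subsetI mem_Collect_eq)
  qed
  then obtain i j where "i < j" "\<phi> i = \<phi> j" by (metis injI linorder_neqE_nat)
  then have ex: "\<exists>m. m > 0 \<and> \<phi> m = x" using cancel[of i j] by (intro exI[of _ "j - i"]) auto
  define m where "m = (LEAST m. m > 0 \<and> \<phi> m = x)"
  have m: "m > 0" "\<phi> m = x" using LeastI_ex[OF ex] by (auto simp: m_def)
  have least: "m \<le> i" if "i > 0" "\<phi> i = x" for i using that by (auto simp: m_def intro: Least_le)
  have inj: "inj_on \<phi> {..<m}"
  proof (rule linorder_inj_onI')
    fix i j assume ij: "i \<in> {..<m}" "j \<in> {..<m}" "i < j"
    then show "\<phi> i \<noteq> \<phi> j" using cancel[of i j] least[of "j - i"] by auto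
  qed
  define H where "H = (\<Prod>i<m. [:- \<phi> i, 1:])"
  have degH: "degree H = m"
    unfolding H_def by (subst degree_prod_eq_sum_degree) auto
  have monicH: "lead_coeff H = 1" by (simp add: H_def lead_coeff_prod)
  \<comment> \<open>Frobenius shifts the factors of \<open>H\<close> by one; since
    \<open>\<phi> m = \<phi> 0\<close>, the shift is cyclic and preserves the product.\<close>
  have "coeff H k ^ q = coeff H k" for k
  proof -
    interpret F: field_hom "\<lambda>x::'c. x ^ (q ^ 1)" by (rule frobenius_hom)
    interpret mF: map_poly_comm_ring_hom "\<lambda>x::'c. x ^ (q ^ 1)" ..
    have shift: "f 0 * (\<Prod>i<m. f (Suc i)) = f m * (\<Prod>i<m. f i)" for f :: "nat \<Rightarrow> 'c poly"
      by (metis mult.commute prod.lessThan_Suc prod.lessThan_Suc_shift)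
    have "map_poly (\<lambda>x. x ^ (q ^ 1)) [:- \<phi> i, 1:] = [:- \<phi> (Suc i), 1:]" for i
      using \<phi>_add[of i 1] F.hom_uminus[of "\<phi> i"] F.hom_zero by (simp add: F.map_poly_pCons_hom)
    then have "map_poly (\<lambda>x. x ^ (q ^ 1)) H = (\<Prod>i<m. [:- \<phi> (Suc i), 1:])"
      unfolding H_def mF.hom_prod by simp
    moreover have "[:- \<phi> 0, 1:] * (\<Prod>i<m. [:- \<phi> (Suc i), 1:]) = [:- \<phi> m, 1:] * H"
      unfolding H_def by (rule shift)
    moreover have "\<phi> 0 = \<phi> m" using m by (simp add: \<phi>_def)
    ultimately have "map_poly (\<lambda>x. x ^ (q ^ 1)) H = H"
      by (metis mult_left_cancel pCons_eq_0_iff zero_neq_one)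
    then show ?thesis by (metis (no_types, lifting) F.hom_zero coeff_map_poly power_one_right)
  qed
  then have "\<forall>k. \<exists>c. coeff H k = h c" using fixed_point_in_range by blast
  then obtain c where c: "\<And>k. coeff H k = h (c k)" by metis
  define g where "g = Poly (map c [0..<Suc m])"
  have H: "H = map_poly h g"
  proof (rule poly_eqI)
    fix k
    have "coeff H k = 0" if "k > m" using that degH by (intro coeff_eq_0) simp
    then show "coeff H k = coeff (map_poly h g) k"
      by (auto simp: g_def nth_default_def c coeff_map_poly simp del: upt_Suc)
  qed
  have degg: "degree g = m" "lead_coeff g = 1" using degH monicH H by auto
  have g0: "g \<noteq> 0" using degg by auto
  have "poly H x = 0" using m(1) by (auto simp: H_def poly_prod \<phi>_def intro!: bexI[of _ 0])
  then have "p dvd g" using irreducible_dvd_of_common_root[OF p(1) x] H by simp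
  then obtain e where e: "g = p * e" by (elim dvdE)
  have e0: "e \<noteq> 0" using e g0 by auto
  have "m = card (\<phi> ` {..<m})" using inj by (simp add: card_image)
  also have "\<dots> \<le> card {y. poly (map_poly h p) y = 0}" using roots fin by (intro card_mono) auto
  also have "\<dots> \<le> degree p" using card_poly_roots_bound[of "map_poly h p"] p0 by simp
  finally have "degree e = 0" using e degg p0 e0 by (simp add: degree_mult_eq)
  moreover have "lead_coeff e = 1" using e degg p by (metis lead_coeff_mult mult_1)
  ultimately have "e = 1" by (metis coeff_pCons_0 degree_0_id one_pCons pCons_eq_iff degree_eq_zeroE)
  then have gp: "g = p" using e by simp
  have mp: "m = degree p" using degg gp by simp
  show "map_poly h p = (\<Prod>i<degree p. [:- (x ^ (q ^ i)), 1:])"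
    using H gp mp by (simp add: H_def \<phi>_def)
  show "x ^ (q ^ degree p) = x" using m mp by (simp add: \<phi>_def)
  show "inj_on (\<lambda>i. x ^ (q ^ i)) {..<degree p}" using inj mp by (simp add: \<phi>_def)
qed

end

section \<open>Counting points\<close>

context finite_field_extension
begin

text \<open>For \<open>x\<close> in the field with \<open>q ^ n\<close> elements, the value at
  \<open>x\<close> is the characteristic polynomial of \<open>x\<close> over the small field,
  evaluated at \<open>al\<close>.\<close>

definition norm_poly :: "nat \<Rightarrow> 'c \<Rightarrow> 'c poly" where
  "norm_poly n al = (\<Prod>j<n. [:al:] - monom 1 (q ^ j))"

lemma poly_norm_poly: "poly (norm_poly n al) x = (\<Prod>j<n. al - x ^ (q ^ j))"
  by (simp add: norm_poly_def poly_prod poly_monom)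

text \<open>The factor for \<open>j\<close> vanishes at \<open>al\<close> only if
  \<open>al ^ (q ^ j) = al\<close>, that is for \<open>j = 0\<close>, and this factor is
  linear.\<close>

lemma order_norm_poly:
  assumes "n > 0" "\<And>j. 0 < j \<Longrightarrow> j < n \<Longrightarrow> al ^ (q ^ j) \<noteq> al"
  shows "norm_poly n al \<noteq> 0" "order al (norm_poly n al) = 1"
proof -
  define P where "P = (\<Prod>j\<in>{..<n} - {0}. [:al:] - monom 1 (q ^ j))"
  have "poly P al \<noteq> 0"
    using assms(2) by (force simp: P_def poly_prod poly_monom prod_zero_iff)
  then have P: "P \<noteq> 0" "order al P = 0" by (auto simp: order_0I)
  have lin: "[:al:] - monom 1 (q ^ 0) = Polynomial.smult (- 1) ([:- al, 1:] ^ 1)"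
    by (simp add: monom_altdef one_pCons del: pCons_one)
  have "norm_poly n al = ([:al:] - monom 1 (q ^ 0)) * P"
    unfolding norm_poly_def P_def using assms(1) by (intro prod.remove) auto
  also have "\<dots> = Polynomial.smult (- 1) ([:- al, 1:] ^ 1 * P)"
    unfolding lin by simp
  finally have G: "norm_poly n al = Polynomial.smult (- 1) ([:- al, 1:] ^ 1 * P)" .
  have nz: "[:- al, 1:] ^ 1 * P \<noteq> 0" using P(1) by (simp del: mult_pCons_left)
  moreover have "order al ([:- al, 1:] ^ 1 * P) = 1"
    unfolding order_mult[OF nz] by (simp only: order_power_n_n P(2) add_0_right)
  moreover define U where "U = [:- al, 1:] ^ 1 * P"
  moreover have "order al (Polynomial.smult (- 1) U) = order al U" by (rule order_smult) simp
  ultimately show "norm_poly n al \<noteq> 0" "order al (norm_poly n al) = 1"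
    unfolding G U_def[symmetric] by simp_all
qed

text \<open>The \<open>(q ^ n) ^ m\<close>-th power fixes \<open>al\<close>, so it turns the factor
  for \<open>i\<close> into the one for \<open>n * m + i\<close>; the blocks with
  \<open>m < s\<close> fill the range below \<open>n * s\<close>.\<close>

lemma norm_poly_power:
  assumes "al ^ (q ^ n) = al"
  shows "poly (norm_poly n al) x ^ (\<Sum>m<s. (q ^ n) ^ m) = (\<Prod>i<n * s. al - x ^ (q ^ i))"
proof (induction s)
  case (Suc s)
  have al: "al ^ (q ^ (n * m)) = al" for m
  proof (induction m)
    case (Suc m)
    have "al ^ (q ^ (n * Suc m)) = (al ^ (q ^ n)) ^ (q ^ (n * m))"
      by (simp add: power_add flip: power_mult)
    then show ?case using assms Suc by simp
  qed simp
  have "(\<Prod>i<n * Suc s. al - x ^ (q ^ i)) =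
      (\<Prod>i<n * s. al - x ^ (q ^ i)) * (\<Prod>i<n. al - x ^ (q ^ (n * s + i)))"
    by (simp add: add.commute[of n] lessThan_atLeast0 prod.atLeastLessThan_concat[symmetric, of 0 "n * s" "n * s + n"]
        prod.atLeastLessThan_shift_0[of _ "n * s"])
  also have "(\<Prod>i<n. al - x ^ (q ^ (n * s + i))) = (\<Prod>i<n. al - x ^ (q ^ i)) ^ ((q ^ n) ^ s)"
  proof -
    have "al - x ^ (q ^ (n * s + i)) = (al - x ^ (q ^ i)) ^ (q ^ (n * s))" for i
      by (simp add: frobenius_diff al power_add mult.commute flip: power_mult)
    then show ?thesis by (simp add: prod_power_distrib power_mult)
  qed
  finally show ?case by (simp only: sum.lessThan_Suc power_add Suc.IH[unfolded poly_norm_poly] poly_norm_poly)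
qed simp

text \<open>The conjugates of \<open>x\<close> recur with period \<open>degree p\<close>, so the
  product runs through the roots of \<open>p\<close> exactly \<open>j\<close> times.\<close>

lemma frobenius_orbit_power:
  assumes p: "irreducible p" "lead_coeff p = 1" and x: "poly (map_poly h p) x = 0"
  shows "poly (map_poly h p) z ^ j = (\<Prod>i<j * degree p. z - x ^ (q ^ i))"
    and "x ^ (q ^ (j * degree p)) = x"
proof -
  let ?d = "degree p"
  note orbit = frobenius_orbit[OF p x]
  have per: "x ^ (q ^ (j * ?d + i)) = x ^ (q ^ i)" for i j
  proof (induction j)
    case (Suc j)
    have "x ^ (q ^ (Suc j * ?d + i)) = (x ^ (q ^ ?d)) ^ (q ^ (j * ?d + i))"
      by (simp add: power_add mult.assoc flip: power_mult)
    then show ?case using orbit(2) Suc by simp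
  qed simp
  show "x ^ (q ^ (j * ?d)) = x" using per[of j 0] by simp
  show "poly (map_poly h p) z ^ j = (\<Prod>i<j * ?d. z - x ^ (q ^ i))"
  proof (induction j)
    case (Suc j)
    have "(\<Prod>i<Suc j * ?d. z - x ^ (q ^ i)) =
        (\<Prod>i<j * ?d. z - x ^ (q ^ i)) * (\<Prod>i<?d. z - x ^ (q ^ (j * ?d + i)))"
      by (simp add: add.commute[of ?d] lessThan_atLeast0 prod.atLeastLessThan_concat[symmetric, of 0 "j * ?d" "j * ?d + ?d"]
          prod.atLeastLessThan_shift_0[of _ "j * ?d"])
    also have "(\<Prod>i<?d. z - x ^ (q ^ (j * ?d + i))) = poly (map_poly h p) z"
      by (simp add: per orbit(1) poly_prod)
    finally show ?case by (simp add: Suc.IH mult.commute)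
  qed simp
qed

lemma card_roots_irreducible:
  assumes p: "irreducible p" "lead_coeff p = 1" and x: "poly (map_poly h p) x = 0"
  shows "finite {y. poly (map_poly h p) y = 0}" "card {y. poly (map_poly h p) y = 0} = degree p"
proof -
  have "{y. poly (map_poly h p) y = 0} = (\<lambda>i. x ^ (q ^ i)) ` {..<degree p}"
    by (auto simp: frobenius_orbit(1)[OF assms] poly_prod)
  then show "finite {y. poly (map_poly h p) y = 0}" "card {y. poly (map_poly h p) y = 0} = degree p"
    using frobenius_orbit(3)[OF assms] by (simp_all add: card_image)
qed

end

text \<open>Each pair contributes the \<open>degree p\<close> roots of \<open>p\<close>, and
  different pairs have disjoint root sets. At such a root, p(al)^j and the power of the norm
  polynomial are the same product over conjugates.\<close>

lemma weighted_count_le_card_points: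
  fixes h :: "'a::{field,finite} \<Rightarrow> 'c::alg_closed_field"
  assumes "finite_field_extension h q" and n: "n > 0" "s > 0" and al: "al ^ (q ^ n) = al"
  shows "(\<Sum>(p, j) | (p, j) \<in> primary_pairs (n * s) \<and> poly (map_poly h p) al ^ j = c. degree p) \<le>
    card {x. x ^ (q ^ (n * s)) = x \<and>
      poly (finite_field_extension.norm_poly q n al) x ^ (\<Sum>m<s. (q ^ n) ^ m) = c}"
proof -
  interpret finite_field_extension h q by fact
  define A where "A = {(p, j). (p, j) \<in> primary_pairs (n * s) \<and> poly (map_poly h p) al ^ j = c}"
  define Z where "Z = (\<lambda>(p::'a poly, j::nat). {y. poly (map_poly h p) y = 0})"
  define Pts where "Pts = {x. x ^ (q ^ (n * s)) = x \<and> poly (norm_poly n al) x ^ (\<Sum>m<s. (q ^ n) ^ m) = c}"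
  have A: "irreducible p" "lead_coeff p = 1" "j * degree p = n * s" "poly (map_poly h p) al ^ j = c"
    if "(p, j) \<in> A" for p j
    using that by (auto simp: A_def primary_pairs_def)
  have "A \<subseteq> primary_pairs (n * s)" by (auto simp: A_def)
  then have finA: "finite A" using finite_primary_pairs n by (meson finite_subset nat_0_less_mult_iff)
  have ex: "\<exists>x. poly (map_poly h p) x = 0" if "(p, j) \<in> A" for p j
    using irreducible_degree_pos[OF A(1)[OF that]] by (intro alg_closed_imp_poly_has_root) simp
  have Z: "finite (Z t)" "card (Z t) = degree (fst t)" if "t \<in> A" for t
    using that ex card_roots_irreducible A(1,2) by (cases t; fastforce simp: Z_def)+
  have "Z t \<inter> Z t' = {}" if tt: "t \<in> A" "t' \<in> A" "t \<noteq> t'" for t t'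
  proof (rule ccontr)
    obtain p j p' j' where t: "t = (p, j)" "t' = (p', j')" by (meson surj_pair)
    assume "Z t \<inter> Z t' \<noteq> {}"
    then obtain y where "poly (map_poly h p) y = 0" "poly (map_poly h p') y = 0"
      by (auto simp: Z_def t)
    then have "p dvd p'" using irreducible_dvd_of_common_root A(1) tt t by blast
    then have "p = p'" using irreducible_monic_dvd_eq A(1,2) tt t by blast
    \<comment> \<open>The exponent is determined by \<open>p\<close>, since
      \<open>j * degree p\<close> is fixed.\<close>
    moreover from this have "j * degree p = j' * degree p" using A(3) tt t by metis
    then have "j = j'" using irreducible_degree_pos[of p] A(1) tt t by auto
    ultimately show False using tt t by simp
  qed
  then have "card (\<Union>t\<in>A. Z t) = (\<Sum>t\<in>A. degree (fst t))"
    using finA Z by (subst card_UN_disjoint) auto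
  moreover have "(\<Union>t\<in>A. Z t) \<subseteq> Pts"
  proof clarify
    fix p j x assume t: "(p, j) \<in> A" and "x \<in> Z (p, j)"
    then have x: "poly (map_poly h p) x = 0" by (simp add: Z_def)
    note o = frobenius_orbit_power[OF A(1,2)[OF t] x, where j = j]
    show "x \<in> Pts"
      unfolding Pts_def norm_poly_power[OF al] using o(1)[of al] o(2) A(3,4)[OF t] by simp
  qed
  moreover have "finite Pts"
  proof (rule finite_subset)
    show "Pts \<subseteq> {x. x ^ (q ^ (n * s)) = x}" by (auto simp: Pts_def)
    show "finite {x::'c. x ^ (q ^ (n * s)) = x}"
      using q_gt_1 n by (intro finite_power_fixed_points one_less_power) auto
  qed
  ultimately have "(\<Sum>t\<in>A. degree (fst t)) \<le> card Pts" by (metis card_mono)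
  then show ?thesis by (simp add: A_def Pts_def case_prod_unfold)
qed

section \<open>Parameters for the point count\<close>

text \<open>With \<open>J = T\<close>, the square root of \<open>R\<close>, and
  \<open>l = M * T - K\<close>, the leading term \<open>J * R / l\<close> is close to
  \<open>R / M\<close>. The deficit \<open>K\<close> gives the linear system its slack, and
  \<open>2 * K \<le> M * T\<close> keeps \<open>l\<close> at least half of
  \<open>M * T\<close>.\<close>

lemma stepanov_parameters:
  fixes Nn E M T D R K :: nat
  assumes R: "R = M * E + 1" "R = T * T" and M: "M > 0" "M \<le> T" "E > 0"
    and K: "K = 2 * M * M * (1 + M * D) + 1" "2 * K \<le> M * T"
    and step: "\<And>J l. l \<le> R \<Longrightarrow> l * (J + E + l * D) < J * M * E \<Longrightarrow> Nn * l \<le> E + J * R + M * E * D"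
  shows "real Nn \<le> real R / real M + (2 * (1 + real D) + 2 * real K) * real T"
proof -
  define l where "l = M * T - K"
  have l: "l + K = M * T" using K(2) by (simp add: l_def)
  have lT: "l \<le> M * T" by (simp add: l_def)
  have "M * T \<le> T * T" using M by simp
  then have lR: "l \<le> R" using R lT by linarith
  have T0: "T > 0" using M by simp
  have "M * (l * (T + E + l * D)) < M * (T * M * E)"
  proof -
    have "l * M * (T + l * D) \<le> (M * T) * M * (T + (M * T) * D)"
      using lT by (intro mult_le_mono add_mono order_refl)
    also have "\<dots> = M * M * (1 + M * D) * R" by (simp add: R(2) algebra_simps)
    \<comment> \<open>\<open>R = M * E + 1\<close> is at most \<open>2 * (M * E)\<close>, whence the
      factor 2 in \<open>K\<close>; the summand 1 there makes the next step strict.\<close>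
    also have "\<dots> \<le> M * M * (1 + M * D) * (2 * (M * E))"
      using M R(1) by (intro mult_le_mono order_refl) (simp add: Suc_leI)
    also have "\<dots> < K * (M * E)" using M by (simp add: K(1) algebra_simps)
    finally have "l * M * (T + l * D) < K * (M * E)" .
    then have "l * M * (T + l * D) + l * (M * E) < (l + K) * (M * E)" by (simp add: algebra_simps)
    then show ?thesis unfolding l by (simp add: algebra_simps)
  qed
  then have "l * (T + E + l * D) < T * M * E" by simp
  from step[OF lR this] have le: "Nn * l \<le> E + T * R + M * E * D" .
  have "E \<le> R" "M * E \<le> R" using R(1) M(1) by (cases M; simp)+
  moreover from this have "M * E * D \<le> R * D" by (intro mult_le_mono1)
  moreover have "R * (1 + D) = R + R * D" by simp
  ultimately have "E + T * R + M * E * D \<le> T * R + R * (1 + D)" by linarith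
  then have "real (Nn * l) \<le> real (T * R + R * (1 + D))" using le by linarith
  then have 1: "real Nn * real l \<le> real T * real R + real R * (1 + real D)" by (simp add: distrib_left)
  have rl: "real l = real M * real T - real K" using l by (metis add_diff_cancel_right' of_nat_add of_nat_mult)
  have "2 * K \<le> M * T" by (rule K(2))
  then have "2 * real K \<le> real M * real T" by (metis of_nat_le_iff of_nat_mult of_nat_numeral)
  then have l2: "real l \<ge> real M * real T / 2" using rl by simp
  moreover have "real M * real T / 2 > 0" using M T0 by simp
  ultimately have lpos: "real l > 0" by linarith
  define C where "C = 2 * (1 + real D) + 2 * real K"
  have M1: "real M \<ge> 1" using M by simp
  have "real T * real R + real R * (1 + real D) \<le> (real R / real M + C * real T) * real l"
  proof -
    \<comment> \<open>The error term pays both for \<open>R * (1 + D)\<close> and for the loss of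
      \<open>R * K / M\<close> in the leading term.\<close>
    have "C * real T * real l \<ge> C * real T * (real M * real T / 2)"
      using l2 by (intro mult_left_mono) (auto simp: C_def)
    moreover have "C * real T * (real M * real T / 2) = real R * (1 + real D + real K) * real M"
      by (simp add: C_def R(2) algebra_simps)
    moreover have "real R * (1 + real D + real K) * real M \<ge> real R * (1 + real D + real K) * 1"
      using M1 by (intro mult_left_mono) auto
    moreover have "real R / real M * real l = real T * real R - real R * (real K / real M)"
      using M by (simp add: rl field_simps)
    moreover have "real R * (real K / real M) \<le> real R * real K"
      using M1 by (intro mult_left_mono) (auto simp: divide_le_eq mult_left_le_one_le mult_le_cancel_left1)
    ultimately show ?thesis by (simp add: algebra_simps)
  qed
  then have "real Nn * real l \<le> (real R / real M + C * real T) * real l" using 1 by linarith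
  then show ?thesis using lpos by (simp add: C_def mult_le_cancel_right)
qed

text \<open>The even exponent makes \<open>R = Q ^ (2 * t)\<close> a square with integral root
  \<open>Q ^ t\<close>. As \<open>K\<close> and \<open>D\<close> do not depend on \<open>t\<close>,
  the size condition holds for all large \<open>t\<close>.\<close>

lemma weighted_count_bound:
  fixes h :: "'a::{field,finite} \<Rightarrow> 'c::alg_closed_field"
  assumes ext: "finite_field_extension h q" and n: "n > 0"
    and al: "al ^ (q ^ n) = al" "\<And>j. 0 < j \<Longrightarrow> j < n \<Longrightarrow> al ^ (q ^ j) \<noteq> al"
  shows "\<exists>C t0. \<forall>t\<ge>t0. \<forall>c. c \<noteq> 0 \<longrightarrow>
    real (\<Sum>(p, j) | (p, j) \<in> primary_pairs (n * (2 * t)) \<and> poly (map_poly h p) al ^ j = c. degree p)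
      \<le> real (q ^ n) ^ (2 * t) / real (q ^ n - 1) + C * real (q ^ n) ^ t"
proof -
  interpret finite_field_extension h q by fact
  define Q where "Q = q ^ n"
  define M where "M = Q - 1"
  define D where "D = degree (norm_poly n al)"
  define K where "K = 2 * M * M * (1 + M * D) + 1"
  have "Q > 1" using one_less_power[OF q_gt_1, of n] n by (simp add: Q_def)
  then have Q: "Q = M + 1" "M > 0" by (simp_all add: M_def)
  have geom: "(M + 1) ^ s = M * (\<Sum>m<s. (M + 1) ^ m) + 1" for s
    by (induction s) (simp_all add: algebra_simps)
  have "real (\<Sum>(p, j) | (p, j) \<in> primary_pairs (n * (2 * t)) \<and> poly (map_poly h p) al ^ j = c. degree p)
      \<le> real Q ^ (2 * t) / real M + (2 * (1 + real D) + 2 * real K) * real Q ^ t"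
    if t: "t \<ge> 2 * K" and c: "c \<noteq> 0" for t c
  proof -
    define E where "E = (\<Sum>m<2 * t. Q ^ m)"
    define G where "G = norm_poly n al"
    have t0: "t > 0" using t by (simp add: K_def)
    have R1: "Q ^ (2 * t) = M * E + 1" unfolding E_def Q by (rule geom)
    have R2: "Q ^ (2 * t) = Q ^ t * Q ^ t" by (simp add: mult_2 power_add)
    have QR: "Q ^ (2 * t) = q ^ (n * (2 * t))" by (simp only: Q_def power_mult)
    have "Q \<le> Q ^ t" using t0 Q by (intro self_le_power) auto
    then have MT: "M \<le> Q ^ t" using Q by linarith
    have "Q ^ 0 \<le> E" unfolding E_def using t0 by (intro member_le_sum) auto
    then have "E > 0" by simp
    have "t < 2 ^ t" by (rule less_exp)
    also have "(2::nat) ^ t \<le> Q ^ t" using Q by (intro power_mono) auto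
    finally have "2 * K \<le> Q ^ t" using t by simp
    also have "\<dots> \<le> M * Q ^ t" using Q(2) by simp
    finally have KT: "2 * K \<le> M * Q ^ t" .
    have G: "G \<noteq> 0" "order al G = 1"
      using order_norm_poly[OF n al(2)] by (simp_all add: G_def)
    have "al ^ (Q ^ s) = al" for s
    proof (induction s)
      case (Suc s)
      have "al ^ (Q ^ Suc s) = (al ^ Q) ^ (Q ^ s)" by (simp flip: power_mult)
      then show ?case using Suc al(1) by (simp add: Q_def)
    qed simp
    note alR = this[of "2 * t"]
    have dream: "(U + V) ^ (Q ^ (2 * t)) = U ^ (Q ^ (2 * t)) + V ^ (Q ^ (2 * t))" for U V :: "'c poly poly"
      unfolding QR by (rule frobenius_add_poly_poly)
    define N where "N = card {x. x ^ (Q ^ (2 * t)) = x \<and> poly G x ^ E = c}"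
    have "N * l \<le> E + J * Q ^ (2 * t) + M * E * D"
      if "l \<le> Q ^ (2 * t)" "l * (J + E + l * D) < J * M * E" for J l
      unfolding N_def D_def G_def[symmetric]
      by (rule stepanov_bound[OF dream R1 Q(2) \<open>E > 0\<close> G(2,1) alR c that(1)])
        (use that(2) in \<open>simp add: D_def G_def\<close>)
    then have "real N \<le> real (Q ^ (2 * t)) / real M + (2 * (1 + real D) + 2 * real K) * real (Q ^ t)"
      by (intro stepanov_parameters[OF R1 R2 Q(2) MT \<open>E > 0\<close> K_def KT])
    moreover have "(\<Sum>(p, j) | (p, j) \<in> primary_pairs (n * (2 * t)) \<and> poly (map_poly h p) al ^ j = c. degree p) \<le> N"
      using weighted_count_le_card_points[OF ext n _ al(1), of "2 * t" c] t0
      unfolding N_def G_def E_def QR Q_def[symmetric] by simp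
    ultimately show ?thesis by (simp del: of_nat_sum)
  qed
  then show ?thesis unfolding Q_def M_def by blast
qed

section \<open>Characters\<close>

text \<open>The field type is read as a ring record \<open>R\<close>, whose multiplicative group is
  cyclic.\<close>

lemma finite_field_generator:
  "\<exists>g::'b::{field,finite}. \<forall>x. x \<noteq> 0 \<longrightarrow> (\<exists>i. x = g ^ i)"
proof -
  define R where "R = (ring_of_type_algebra :: 'b ring)"
  interpret R: Ring.field R unfolding R_def by (rule field_from_type_algebra)
  have carrier: "carrier R = UNIV" "\<zero>\<^bsub>R\<^esub> = 0" by (simp_all add: R_def ring_of_type_algebra_def)
  have pow: "x [^]\<^bsub>R\<^esub> i = x ^ i" for x and i :: nat
    by (induction i) (simp_all add: R_def ring_of_type_algebra_def nat_pow_def mult.commute)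
  obtain g where "carrier (mult_of R) = {g [^]\<^bsub>R\<^esub> i | i::nat. i \<in> UNIV}"
    using R.finite_field_mult_group_has_gen by (auto simp: carrier)
  then have "- {0} = {g ^ i | i::nat. True}" by (auto simp: carrier pow)
  then show ?thesis by (intro exI[of _ g]) blast
qed

lemma sum_powers_root_of_unity:
  fixes w :: complex
  assumes "w ^ M = 1" "w \<noteq> 1"
  shows "(\<Sum>i<M. w ^ i) = 0"
  using geometric_sum[OF assms(2), of M] assms(1) by simp

text \<open>With \<open>dl\<close> the discrete logarithm to a generator, \<open>\<chi> k x\<close>
  is exp(2 \<pi> i k dl(x) / M) for nonzero \<open>x\<close>. Both orthogonality relations are
  geometric sums.\<close>

lemma exists_characters:
  defines "M \<equiv> CARD('b::{field,finite}) - 1"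
  shows "\<exists>\<chi> :: nat \<Rightarrow> 'b \<Rightarrow> complex. \<forall>k<M.
    \<chi> k 0 = 0 \<and> \<chi> k 1 = 1 \<and> (\<forall>x y. \<chi> k (x * y) = \<chi> k x * \<chi> k y) \<and> (\<forall>x. cmod (\<chi> k x) \<le> 1) \<and>
    (\<forall>x. x \<noteq> 0 \<longrightarrow> \<chi> 0 x = 1) \<and> (k \<noteq> 0 \<longrightarrow> (\<Sum>x\<in>UNIV. \<chi> k x) = 0) \<and>
    (\<forall>x. x \<noteq> 0 \<longrightarrow> (\<Sum>k<M. \<chi> k x) = (if x = 1 then of_nat M else 0))"
proof -
  obtain g :: 'b where g: "\<And>x. x \<noteq> 0 \<Longrightarrow> \<exists>i. x = g ^ i" using finite_field_generator by blast
  have card: "card (- {0::'b}) = M"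
    unfolding M_def by (simp add: Compl_eq_Diff_UNIV)
  have "(1::'b) \<in> - {0}" by simp
  then have M: "M > 0" unfolding card[symmetric] by (metis card_gt_0_iff empty_iff finite)
  have "x ^ M = 1" if "x \<noteq> 0" for x :: 'b
  proof -
    have "x * x ^ M = x ^ CARD('b)" using M by (simp add: M_def flip: power_Suc)
    then show ?thesis using that by (simp add: finite_field_power_card)
  qed
  moreover have g0: "g \<noteq> 0" if "M > 1"
  proof
    assume "g = 0"
    have "x = 1" if "x \<noteq> 0" for x :: 'b
      using g[OF that] \<open>g = 0\<close> that by (metis power_0_left)
    then have "- {0::'b} = {1}" by auto
    then show False using card \<open>M > 1\<close> by simp
  qed
  ultimately have gM: "g ^ M = 1" if "M > 1" using that by blast
  \<comment> \<open>For \<open>M = 1\<close> the element \<open>g\<close> may be 0, since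
    \<open>0 ^ 0 = 1\<close>; the generator is then taken to be 1.\<close>
  define g' where "g' = (if M > 1 then g else 1)"
  have g': "g' \<noteq> 0" "g' ^ M = 1" using g0 gM by (auto simp: g'_def)
  have g'_gen: "\<exists>i<M. x = g' ^ i" if x: "x \<noteq> 0" for x
  proof (cases "M > 1")
    case True
    obtain i where "x = g' ^ i" using g[OF x] True by (auto simp: g'_def)
    also have "\<dots> = g' ^ (M * (i div M) + i mod M)" by simp
    also have "\<dots> = g' ^ (i mod M)" using g' by (simp only: power_add power_mult power_one mult_1)
    finally show ?thesis using M by (intro exI[of _ "i mod M"]) simp
  next
    case False
    then have "M = 1" using M by simp
    then obtain y where "- {0::'b} = {y}" using card by (metis card_1_singletonE)
    then have "x = 1" using x \<open>1 \<in> - {0}\<close> by (metis ComplI singletonD)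
    then show ?thesis using M by (intro exI[of _ 0]) simp
  qed
  have surj: "(\<lambda>i. g' ^ i) ` {..<M} = - {0}"
    using g'_gen g' by (auto simp: image_iff)
  have inj: "inj_on (\<lambda>i. g' ^ i) {..<M}"
    by (rule eq_card_imp_inj_on) (simp_all add: surj card)
  define dl where "dl = the_inv_into {..<M} (\<lambda>i. g' ^ i)"
  have dl: "g' ^ dl x = x" "dl x < M" if "x \<noteq> 0" for x
  proof -
    have "x \<in> (\<lambda>i. g' ^ i) ` {..<M}" using that surj by simp
    then show "g' ^ dl x = x" "dl x < M"
      using f_the_inv_into_f[OF inj] the_inv_into_into[OF inj _ order_refl] by (auto simp: dl_def)
  qed
  have dl_pow: "dl (g' ^ i) = i" if "i < M" for i
    using the_inv_into_f_f[OF inj] that by (simp add: dl_def)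
  define w where "w = (\<lambda>k::nat. cis (2 * pi * real k / real M))"
  have wM: "w k ^ M = 1" for k using M cis_multiple_2pi[of "real k"] by (simp add: w_def DeMoivre mult_ac)
  have w1: "w k = 1 \<longleftrightarrow> k = 0" if "k < M" for k
  proof -
    have "inj_on w {..<M}" using bij_betw_roots_unity[OF M] by (simp add: bij_betw_def w_def)
    moreover have "w 0 = 1" by (simp add: w_def)
    ultimately show ?thesis using that M by (metis inj_on_def lessThan_iff)
  qed
  \<comment> \<open>This symmetry turns the sum over the characters into a geometric sum as
    well.\<close>
  have w_comm: "w k ^ i = w i ^ k" for i k by (simp add: w_def DeMoivre mult_ac)
  define \<chi> where "\<chi> = (\<lambda>k x. if x = 0 then 0 else w k ^ dl x)"
  have mult: "\<chi> k (x * y) = \<chi> k x * \<chi> k y" for k x y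
  proof (cases "x = 0 \<or> y = 0")
    case False
    define i where "i = dl x + dl y"
    have "x * y = g' ^ i" using dl(1) False by (simp add: i_def power_add)
    also have "\<dots> = g' ^ (M * (i div M) + i mod M)" by simp
    also have "\<dots> = g' ^ (i mod M)" using g' by (simp only: power_add power_mult power_one mult_1)
    finally have "dl (x * y) = i mod M" using dl_pow M by simp
    moreover have "w k ^ i = w k ^ (i mod M)"
    proof -
      have "w k ^ i = w k ^ (M * (i div M) + i mod M)" by simp
      then show ?thesis using wM by (simp only: power_add power_mult power_one mult_1)
    qed
    ultimately show ?thesis using False by (simp add: \<chi>_def i_def power_add)
  qed (auto simp: \<chi>_def)
  have dl1: "dl 1 = 0" using dl_pow[of 0] M by simp
  have sum_x: "(\<Sum>x\<in>UNIV. \<chi> k x) = 0" if k: "k < M" "k \<noteq> 0" for k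
  proof -
    have "(\<Sum>x\<in>UNIV. \<chi> k x) = (\<Sum>x\<in>- {0}. \<chi> k x)"
      by (intro sum.mono_neutral_right) (auto simp: \<chi>_def)
    also have "\<dots> = (\<Sum>i<M. \<chi> k (g' ^ i))"
      unfolding surj[symmetric] by (simp add: sum.reindex[OF inj])
    also have "\<dots> = (\<Sum>i<M. w k ^ i)" using g' dl_pow by (intro sum.cong) (auto simp: \<chi>_def)
    also have "\<dots> = 0" using k w1 wM by (intro sum_powers_root_of_unity) auto
    finally show ?thesis .
  qed
  have sum_k: "(\<Sum>k<M. \<chi> k x) = (if x = 1 then of_nat M else 0)" if x: "x \<noteq> 0" for x
  proof (cases "x = 1")
    case True
    then show ?thesis by (simp add: \<chi>_def dl1)
  next
    case False
    then have "dl x \<noteq> 0" using dl(1)[OF x] by (metis power_0)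
    then have "w (dl x) \<noteq> 1" using w1[OF dl(2)[OF x]] by simp
    have "(\<Sum>k<M. \<chi> k x) = (\<Sum>k<M. w (dl x) ^ k)" using x by (simp add: \<chi>_def w_comm)
    also have "\<dots> = 0" using \<open>w (dl x) \<noteq> 1\<close> wM by (intro sum_powers_root_of_unity) auto
    finally show ?thesis using False by simp
  qed
  have "w 0 = 1" by (simp add: w_def)
  moreover have "cmod (\<chi> k x) \<le> 1" for k x by (simp add: \<chi>_def w_def norm_power)
  moreover have "\<chi> k 0 = 0" "\<chi> k 1 = 1" for k by (simp_all add: \<chi>_def dl1)
  moreover have "\<chi> 0 x = 1" if "x \<noteq> 0" for x using that \<open>w 0 = 1\<close> by (simp add: \<chi>_def)
  ultimately show ?thesis using mult sum_x sum_k by (intro exI[of _ \<chi>]) blast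
qed

section \<open>The character sum bound\<close>

locale generated_extension =
  fixes \<iota> :: "'a::{field,finite} \<Rightarrow> 'b::{field,finite}" and f :: "'a poly" and \<alpha> :: 'b and q n :: nat
  assumes hom: "field_hom \<iota>" and q_def: "q = CARD('a)" and card_b: "CARD('b) = q ^ n" and n: "n > 1"
    and f: "irreducible f" "degree f = n" "eval_at \<iota> \<alpha> f = 0"
begin

sublocale finite_field_extension \<iota> q
  by (rule finite_field_extension.intro[OF hom q_def])

abbreviation ev :: "'a poly \<Rightarrow> 'b" where "ev \<equiv> eval_at \<iota> \<alpha>"

lemma ev_mult: "ev (g * h) = ev g * ev h"
  and ev_add: "ev (g + h) = ev g + ev h"
  and ev_1: "ev 1 = 1"
  and ev_0: "ev 0 = 0"
  by (simp_all add: eval_at_def mh.hom_mult mh.hom_add)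

lemma ev_power: "ev (g ^ k) = ev g ^ k"
  by (induction k) (simp_all add: ev_1 ev_mult)

lemma ev_surj: "\<exists>v. degree v < n \<and> ev v = y"
proof -
  have "Gamma_set \<iota> \<alpha> = - {0}"
    using hom f card_b by (intro Gamma_set_eq[of \<iota> f]) (simp_all add: q_def)
  then have "y \<in> range ev" using ev_0 by (cases "y = 0") (auto simp: Gamma_set_def)
  then obtain g where g: "y = ev g" by blast
  have "ev g = ev (g div f * f + g mod f)" by simp
  also have "\<dots> = ev (g mod f)" unfolding ev_add ev_mult f by simp
  finally have "ev (g mod f) = y" using g by simp
  moreover have "degree (g mod f) < n"
    using degree_mod_less'[of f g] f n by (cases "g mod f = 0") auto
  ultimately show ?thesis by blast
qed

lemma ev_nonzero:
  assumes "g \<noteq> 0" "degree g < n"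
  shows "ev g \<noteq> 0"
proof
  assume "ev g = 0"
  then have "f dvd g" using irreducible_dvd_of_common_root[OF f(1)] f(3) by (simp add: eval_at_def)
  then have "degree f \<le> degree g" using assms(1) by (rule dvd_imp_degree_le)
  then show False using assms(2) f(2) by simp
qed

lemma ev_eq_0_unique:
  assumes "irreducible p" "lead_coeff p = 1" "ev p = 0" "irreducible p'" "lead_coeff p' = 1" "ev p' = 0"
  shows "p = p'"
proof -
  have "p dvd p'"
    using assms(3,6) by (intro irreducible_dvd_of_common_root[OF assms(1)]) (simp_all add: eval_at_def)
  then show ?thesis by (rule irreducible_monic_dvd_eq[OF assms(1,4,2,5)])
qed

text \<open>Once made monic, \<open>f\<close> is irreducible of degree \<open>n\<close> with root
  \<open>\<alpha>\<close>, so the first \<open>n\<close> conjugates of \<open>\<alpha>\<close> are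
  distinct.\<close>

lemma frobenius_alpha:
  shows "\<alpha> ^ (q ^ n) = \<alpha>" and "0 < j \<Longrightarrow> j < n \<Longrightarrow> \<alpha> ^ (q ^ j) \<noteq> \<alpha>"
proof -
  show "\<alpha> ^ (q ^ n) = \<alpha>" using finite_field_power_card[of \<alpha>] by (simp add: card_b)
  define p where "p = Polynomial.smult (inverse (lead_coeff f)) f"
  have f0: "f \<noteq> 0" using f by auto
  have p: "irreducible p" "lead_coeff p = 1" "degree p = n" "poly (map_poly \<iota> p) \<alpha> = 0"
    using f f0 by (auto simp: p_def eval_at_def map_poly_hom_smult)
  assume "0 < j" "j < n"
  then show "\<alpha> ^ (q ^ j) \<noteq> \<alpha>"
    using inj_onD[OF frobenius_orbit(3)[OF p(1,2,4)], of j 0] p(3) by auto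
qed

definition weighted_count :: "nat \<Rightarrow> 'b \<Rightarrow> nat" where
  "weighted_count r c = (\<Sum>(p, j) | (p, j) \<in> primary_pairs r \<and> ev p ^ j = c. degree p)"

text \<open>The point count uses roots of every \<open>p\<close>, so it takes place in an algebraic
  closure of the big field; the embedding is injective and preserves the counts.\<close>

lemma weighted_count_le:
  "\<exists>C t0. \<forall>t\<ge>t0. \<forall>c. c \<noteq> 0 \<longrightarrow> real (weighted_count (n * (2 * t)) c) \<le>
    real (q ^ n) ^ (2 * t) / real (q ^ n - 1) + C * real (q ^ n) ^ t"
proof -
  interpret ac: field_hom "to_ac :: 'b \<Rightarrow> 'b alg_closure" by unfold_locales auto
  have "field_hom (to_ac \<circ> \<iota>)"
    by unfold_locales (auto simp: hom_mult hom_add)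
  then have ext: "finite_field_extension (to_ac \<circ> \<iota>) q"
    using q_def by (rule finite_field_extension.intro)
  have ev: "poly (map_poly (to_ac \<circ> \<iota>) p) (to_ac \<alpha>) = to_ac (ev p)" for p
  proof -
    have "map_poly (to_ac \<circ> \<iota>) p = map_poly to_ac (map_poly \<iota> p)"
      by (rule map_poly_map_poly[symmetric]) auto
    then show ?thesis by (simp add: eval_at_def)
  qed
  have "to_ac \<alpha> ^ (q ^ n) = to_ac \<alpha>" "\<And>j. 0 < j \<Longrightarrow> j < n \<Longrightarrow> to_ac \<alpha> ^ (q ^ j) \<noteq> to_ac \<alpha>"
    using frobenius_alpha by (simp_all flip: to_ac_power)
  from weighted_count_bound[OF ext _ this] n obtain C t0 where
    *: "\<And>t c. t \<ge> t0 \<Longrightarrow> c \<noteq> 0 \<Longrightarrow>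
      real (\<Sum>(p, j) | (p, j) \<in> primary_pairs (n * (2 * t)) \<and> to_ac (ev p) ^ j = c. degree p)
        \<le> real (q ^ n) ^ (2 * t) / real (q ^ n - 1) + C * real (q ^ n) ^ t"
    unfolding ev by auto
  show ?thesis
  proof (intro exI allI impI)
    fix t c assume "t \<ge> t0" "(c::'b) \<noteq> 0"
    then show "real (weighted_count (n * (2 * t)) c) \<le>
        real (q ^ n) ^ (2 * t) / real (q ^ n - 1) + C * real (q ^ n) ^ t"
      using *[of t "to_ac c"] unfolding weighted_count_def to_ac_power[symmetric] to_ac_eq_iff by simp
  qed
qed

text \<open>Only one monic irreducible vanishes at \<open>\<alpha>\<close>, and it divides
  \<open>f\<close>; its exponent is determined by \<open>r\<close>, so at most one pair
  contributes.\<close>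

lemma weighted_count_0_le:
  assumes "r > 0"
  shows "weighted_count r 0 \<le> n"
proof (cases "{(p, j). (p, j) \<in> primary_pairs r \<and> ev p ^ j = 0} = {}")
  case False
  let ?A = "{(p, j). (p, j) \<in> primary_pairs r \<and> ev p ^ j = 0}"
  obtain p j where pj: "(p, j) \<in> ?A" using False by auto
  have A: "irreducible p'" "lead_coeff p' = 1" "ev p' = 0" "j' * degree p' = r"
    if "(p', j') \<in> ?A" for p' j'
    using that by (auto simp: primary_pairs_def)
  have "p' = p \<and> j' = j" if t: "(p', j') \<in> ?A" for p' j'
  proof -
    have "p' = p" using A(1-3)[OF t] A(1-3)[OF pj] by (rule ev_eq_0_unique)
    moreover have "j' * degree p = j * degree p" using A(4)[OF t] A(4)[OF pj] \<open>p' = p\<close> by simp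
    ultimately show ?thesis using irreducible_degree_pos[OF A(1)[OF pj]] by simp
  qed
  then have "?A = {(p, j)}" using pj by blast
  then have "weighted_count r 0 = degree p" by (simp add: weighted_count_def)
  moreover have "p dvd f"
    using irreducible_dvd_of_common_root[OF A(1)[OF pj]] A(3)[OF pj] f(3) by (simp add: eval_at_def)
  then have "degree p \<le> n" using f n by (metis dvd_imp_degree_le irreducible_def)
  ultimately show ?thesis by simp
qed (simp only: weighted_count_def sum.empty le0)

lemma primary_sum_eq_weighted_count:
  assumes "r > 0" "\<And>x y. \<chi> (x * y) = \<chi> x * \<chi> y" "\<chi> 1 = 1"
  shows "primary_sum (\<lambda>g. \<chi> (ev g)) r = (\<Sum>c\<in>UNIV. of_nat (weighted_count r c) * \<chi> c)"
proof -
  have pow: "\<chi> x ^ j = \<chi> (x ^ j)" for x j by (induction j) (simp_all add: assms)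
  have fin: "finite (primary_pairs r :: ('a poly \<times> nat) set)" using assms by (intro finite_primary_pairs)
  have "of_nat (weighted_count r c) * \<chi> c =
      (\<Sum>t | t \<in> primary_pairs r \<and> (case t of (p, j) \<Rightarrow> ev p ^ j) = c. of_nat (degree (fst t)) * \<chi> (ev (fst t) ^ snd t))" for c
    unfolding weighted_count_def of_nat_sum sum_distrib_right
    by (intro sum.cong) auto
  then have "(\<Sum>c\<in>UNIV. of_nat (weighted_count r c) * \<chi> c) =
      (\<Sum>t\<in>primary_pairs r. of_nat (degree (fst t)) * \<chi> (ev (fst t) ^ snd t))"
    using sum.group[OF fin finite_class.finite_UNIV, of "\<lambda>(p, j). ev p ^ j"] by simp
  then show ?thesis by (simp add: primary_sum_def pow case_prod_unfold)
qed

context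
  fixes \<chi> :: "'b \<Rightarrow> complex"
  assumes chi_0: "\<chi> 0 = 0" and chi_1: "\<chi> 1 = 1" and chi_mult: "\<And>x y. \<chi> (x * y) = \<chi> x * \<chi> y"
    and chi_norm: "\<And>x. cmod (\<chi> x) \<le> 1" and chi_sum: "(\<Sum>x\<in>UNIV. \<chi> x) = 0"
begin

text \<open>Adding a polynomial of degree less than \<open>n\<close> permutes the monic polynomials of degree \<open>k\<close>, so the
  sum equals its average over all translates of the values.\<close>

lemma character_sum_monics_eq_0:
  assumes k: "k \<ge> n"
  shows "(\<Sum>g\<in>monics k. \<chi> (ev g)) = 0"
proof -
  have shift: "(\<Sum>g\<in>monics k. \<chi> (ev g)) = (\<Sum>g\<in>monics k. \<chi> (y + ev g))" for y
  proof -
    obtain v where v: "degree v < n" "ev v = y" using ev_surj by blast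
    have mem: "g + v \<in> monics k \<and> g - v \<in> monics k" if "g \<in> monics k" for g
    proof -
      have g: "degree v < degree g" "lead_coeff g = 1" "degree g = k" using that v k by (auto simp: monics_def)
      have "degree (g + v) = k" "degree (g - v) = k"
        using g degree_add_eq_left[of v g] degree_add_eq_left[of "- v" g] by auto
      then show ?thesis using g by (simp add: monics_def coeff_eq_0)
    qed
    have "(\<Sum>g\<in>monics k. \<chi> (ev g)) = (\<Sum>g\<in>monics k. \<chi> (ev (g + v)))"
      using mem by (intro sum.reindex_bij_witness[of _ "\<lambda>g. g + v" "\<lambda>g. g - v"]) auto
    then show ?thesis by (simp add: ev_add v add.commute)
  qed
  have "of_nat CARD('b) * (\<Sum>g\<in>monics k. \<chi> (ev g)) = (\<Sum>y\<in>UNIV. \<Sum>g\<in>monics k. \<chi> (y + ev g))"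
    by (simp flip: shift)
  also have "\<dots> = (\<Sum>g\<in>monics k. \<Sum>y\<in>UNIV. \<chi> (y + ev g))" by (rule sum.swap)
  also have "\<dots> = (\<Sum>g\<in>(monics k :: 'a poly set). 0)"
  proof (intro sum.cong refl)
    fix g
    have "(\<Sum>y\<in>UNIV. \<chi> (y + ev g)) = (\<Sum>y\<in>UNIV. \<chi> y)"
      by (intro sum.reindex_bij_witness[of _ "\<lambda>y. y - ev g" "\<lambda>y. y + ev g"]) auto
    then show "(\<Sum>y\<in>UNIV. \<chi> (y + ev g)) = 0" by (simp add: chi_sum)
  qed
  finally show ?thesis by simp
qed

text \<open>Since \<open>\<chi>\<close> sums to zero, each count may be replaced by its defect
  \<open>e c\<close> from the upper bound \<open>B\<close>. The defects are nonnegative, so their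
  total bounds the sum, and it is O(Q^t) because the counts add up to \<open>q ^ r\<close>.\<close>

lemma character_sum_bound_even:
  "\<exists>C t0. \<forall>t\<ge>t0. cmod (primary_sum (\<lambda>g. \<chi> (ev g)) (n * (2 * t))) \<le> C * real (q ^ n) ^ t"
proof -
  define Q where "Q = q ^ n"
  define M where "M = real (Q - 1)"
  obtain C t0 where *: "\<And>t c. t \<ge> t0 \<Longrightarrow> c \<noteq> 0 \<Longrightarrow> real (weighted_count (n * (2 * t)) c) \<le>
      real Q ^ (2 * t) / M + C * real Q ^ t"
    using weighted_count_le unfolding Q_def M_def by blast
  have "Q > 1" using one_less_power[OF q_gt_1, of n] n by (simp add: Q_def)
  then have M: "M > 0" by (simp add: M_def)
  have cardS: "real (card (- {0::'b})) = M"
    using card_b by (simp add: M_def Q_def Compl_eq_Diff_UNIV)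
  have "cmod (primary_sum (\<lambda>g. \<chi> (ev g)) (n * (2 * t))) \<le> (M * C + real n) * real Q ^ t"
    if t: "t \<ge> max t0 1" for t
  proof -
    define r where "r = n * (2 * t)"
    define B where "B = real Q ^ (2 * t) / M + C * real Q ^ t"
    define e where "e = (\<lambda>c. B - real (weighted_count r c))"
    have r: "r > 0" using t n by (simp add: r_def)
    have e: "e c \<ge> 0" if "c \<noteq> 0" for c using *[of t c] that t by (simp add: e_def B_def r_def)
    have chi_sum': "(\<Sum>c\<in>- {0}. \<chi> c) = 0"
      using chi_sum chi_0 by (simp add: Compl_eq_Diff_UNIV sum_diff1)
    \<comment> \<open>The constant function 1 is multiplicative, so the total is the
      \<open>primary_sum\<close> of 1.\<close>
    have "real (q ^ r) = (\<Sum>c\<in>UNIV. real (weighted_count r c))"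
    proof -
      have "of_nat (q ^ r) = (\<Sum>c\<in>UNIV. of_nat (weighted_count r c) * (1::complex))"
        using primary_sum_eq_weighted_count[OF r, of "\<lambda>_. 1"] primary_sum_one[of r, where ?'a = 'a] r
        by (simp add: q_def)
      then have "of_nat (q ^ r) = (of_nat (\<Sum>c\<in>UNIV. weighted_count r c) :: complex)" by simp
      then have "q ^ r = (\<Sum>c\<in>UNIV. weighted_count r c)" by (simp only: of_nat_eq_iff)
      then show ?thesis by simp
    qed
    also have "\<dots> = (\<Sum>c\<in>- {0}. real (weighted_count r c)) + real (weighted_count r 0)"
      by (simp add: Compl_eq_Diff_UNIV sum_diff1)
    finally have total: "(\<Sum>c\<in>- {0}. real (weighted_count r c)) = real (q ^ r) - real (weighted_count r 0)"
      by simp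
    have "primary_sum (\<lambda>g. \<chi> (ev g)) r = (\<Sum>c\<in>UNIV. of_nat (weighted_count r c) * \<chi> c)"
      by (intro primary_sum_eq_weighted_count r chi_mult chi_1)
    also have "\<dots> = (\<Sum>c\<in>- {0}. of_nat (weighted_count r c) * \<chi> c)"
      by (intro sum.mono_neutral_right) (auto simp: chi_0)
    also have "\<dots> = (\<Sum>c\<in>- {0}. of_real B * \<chi> c - of_real (e c) * \<chi> c)"
      by (intro sum.cong refl) (simp add: e_def algebra_simps)
    also have "\<dots> = - (\<Sum>c\<in>- {0}. of_real (e c) * \<chi> c)"
      by (simp add: sum_subtractf chi_sum' flip: sum_distrib_left)
    finally have "cmod (primary_sum (\<lambda>g. \<chi> (ev g)) r) = cmod (\<Sum>c\<in>- {0}. of_real (e c) * \<chi> c)"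
      by simp
    also have "\<dots> \<le> (\<Sum>c\<in>- {0}. cmod (of_real (e c) * \<chi> c))" by (rule norm_sum)
    also have "\<dots> \<le> (\<Sum>c\<in>- {0}. e c * 1)"
    proof (intro sum_mono)
      fix c :: 'b assume "c \<in> - {0}"
      then have "e c \<ge> 0" using e by simp
      then show "cmod (of_real (e c) * \<chi> c) \<le> e c * 1"
        using mult_left_mono[OF chi_norm[of c]] by (simp add: norm_mult)
    qed
    also have "\<dots> = M * B - real (q ^ r) + real (weighted_count r 0)"
      by (simp add: e_def sum_subtractf total cardS[symmetric])
    also have "M * B = real Q ^ (2 * t) + M * C * real Q ^ t"
      using M by (simp add: B_def distrib_left)
    also have "real Q ^ (2 * t) = real (q ^ r)" by (simp add: Q_def r_def power_mult)
    also have "real (q ^ r) + M * C * real Q ^ t - real (q ^ r) + real (weighted_count r 0) \<le>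
        M * C * real Q ^ t + real n * 1"
      using weighted_count_0_le[OF r] by simp
    also have "\<dots> \<le> M * C * real Q ^ t + real n * real Q ^ t"
      using \<open>Q > 1\<close> by (intro add_left_mono mult_left_mono one_le_power) auto
    finally show ?thesis by (simp add: r_def distrib_right)
  qed
  then show ?thesis unfolding Q_def by blast
qed

text \<open>The even case bounds the power sums of the w^(2n), where w runs through the inverse
  roots of the L-function. This forces \<bar>w\<bar> to be at most the square root of q, and there
  are fewer than \<open>n\<close> of them.\<close>

theorem character_sum_bound:
  assumes d: "d \<ge> 1"
  shows "cmod (primary_sum (\<lambda>g. \<chi> (ev g)) d) \<le> real (n - 1) * sqrt (real q) ^ d"
proof -
  define F where "F = (\<lambda>g. \<chi> (ev g))"
  obtain ws where ws: "length ws < n" "\<And>r. r \<ge> 1 \<Longrightarrow> primary_sum F r = - (\<Sum>w\<leftarrow>ws. w ^ r)"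
  proof -
    have "\<exists>ws. length ws < n \<and> (\<forall>r\<ge>1. primary_sum F r = - (\<Sum>w\<leftarrow>ws. w ^ r))"
    proof (rule newton_identities_power_sums[of "\<lambda>k. \<Sum>g\<in>monics k. F g"])
      show "(\<Sum>g\<in>monics 0. F g) = 1" by (simp add: monics_0 F_def ev_1 chi_1)
      show "(\<Sum>g\<in>monics k. F g) = 0" if "n \<le> k" for k
        unfolding F_def by (rule character_sum_monics_eq_0[OF that])
      show "of_nat k * (\<Sum>g\<in>monics k. F g) = (\<Sum>r=1..k. primary_sum F r * (\<Sum>g\<in>monics (k - r). F g))" for k
        by (rule primary_sum_recurrence) (simp_all add: F_def ev_mult ev_1 chi_mult chi_1)
    qed
    then show ?thesis using that by blast
  qed
  obtain C t0 where C: "\<And>t. t \<ge> t0 \<Longrightarrow> cmod (primary_sum F (n * (2 * t))) \<le> C * real (q ^ n) ^ t"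
    using character_sum_bound_even unfolding F_def by blast
  have root: "cmod w \<le> sqrt (real q)" if w: "w \<in> set ws" for w
  proof -
    have "cmod (w ^ (2 * n)) \<le> real (q ^ n)"
    proof (rule norm_le_of_power_sums_le[where ws = "map (\<lambda>w. w ^ (2 * n)) ws" and ?s0.0 = "max t0 1" and C = C])
      show "real (q ^ n) > 0" using q_gt_1 by simp
      show "w ^ (2 * n) \<in> set (map (\<lambda>w. w ^ (2 * n)) ws)" using w by auto
      fix s assume s: "max t0 1 \<le> s"
      have "(\<Sum>v\<leftarrow>map (\<lambda>w. w ^ (2 * n)) ws. v ^ s) = (\<Sum>w\<leftarrow>ws. w ^ (n * (2 * s)))"
        by (simp add: o_def mult_ac flip: power_mult)
      also have "cmod \<dots> = cmod (primary_sum F (n * (2 * s)))"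
        using ws(2)[of "n * (2 * s)"] n s by simp
      finally show "cmod (\<Sum>v\<leftarrow>map (\<lambda>w. w ^ (2 * n)) ws. v ^ s) \<le> C * real (q ^ n) ^ s"
        using C[of s] s by simp
    qed
    also have "real (q ^ n) = sqrt (real q) ^ (2 * n)" by (simp add: power_mult)
    finally have "cmod w ^ (2 * n) \<le> sqrt (real q) ^ (2 * n)" by (simp add: norm_power)
    then show ?thesis using n by (subst (asm) power_mono_iff) auto
  qed
  have "cmod (primary_sum F d) = cmod (\<Sum>w\<leftarrow>ws. w ^ d)" using ws(2)[OF d] by simp
  also have "\<dots> \<le> (\<Sum>w\<leftarrow>ws. cmod (w ^ d))" by (induction ws) (auto intro: norm_triangle_le)
  also have "\<dots> \<le> (\<Sum>w\<leftarrow>ws. sqrt (real q) ^ d)"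
    using root by (intro sum_list_mono) (auto simp: norm_power intro: power_mono)
  also have "\<dots> = real (length ws) * sqrt (real q) ^ d" by (simp add: sum_list_triv)
  also have "\<dots> \<le> real (n - 1) * sqrt (real q) ^ d" using ws(1) by (intro mult_right_mono) auto
  finally show ?thesis by (simp add: F_def)
qed

end

end

section \<open>The diameter\<close>

text \<open>Counts ordered factorizations of \<open>\<beta>\<close> into \<open>k\<close> values of
  primary polynomials, weighted by the product of the degrees of the bases \<open>p\<close>, as the
  weights of \<open>primary_sum\<close> require.\<close>

fun walk_count :: "('a::field poly \<Rightarrow> 'b::field) \<Rightarrow> nat \<Rightarrow> nat \<Rightarrow> 'b \<Rightarrow> nat" where
  "walk_count e d 0 \<beta> = (if \<beta> = 1 then 1 else 0)"
| "walk_count e d (Suc k) \<beta> = (\<Sum>(p, j)\<in>primary_pairs d. degree p * walk_count e d k (\<beta> / e p ^ j))"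

lemma P_set_primary_pairs:
  assumes "(p, j) \<in> primary_pairs d" "d > 0"
  shows "p ^ j \<in> P_set d"
  using primary_pairs_monic[OF assms(1)] assms
  by (auto simp: P_set_def monics_def primary_poly_def primary_pairs_def)

context generated_extension
begin

lemma ev_primary_pair_nonzero:
  assumes "(p, j) \<in> primary_pairs d" "d < n"
  shows "ev p ^ j \<noteq> 0"
proof -
  have m: "lead_coeff (p ^ j) = 1" "degree (p ^ j) = d"
    using primary_pairs_monic[OF assms(1)] unfolding monics_def by blast+
  then have "p ^ j \<noteq> 0" by (metis coeff_0 zero_neq_one)
  then show ?thesis using ev_nonzero[of "p ^ j"] m(2) assms(2) by (simp only: ev_power) simp
qed

lemma product_of_walk_count:
  assumes "walk_count ev d k \<beta> \<noteq> 0" "0 < d" "d < n"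
  shows "\<exists>xs. length xs = k \<and> set xs \<subseteq> E_set \<iota> \<alpha> d \<and> prod_list xs = \<beta>"
  using assms(1)
proof (induction k arbitrary: \<beta>)
  case 0
  then show ?case by (intro exI[of _ "[]"]) (simp split: if_splits)
next
  case (Suc k)
  then have "(\<Sum>(p, j)\<in>primary_pairs d. degree p * walk_count ev d k (\<beta> / ev p ^ j)) \<noteq> 0"
    by simp
  then obtain t where "t \<in> primary_pairs d"
    "(case t of (p, j) \<Rightarrow> degree p * walk_count ev d k (\<beta> / ev p ^ j)) \<noteq> 0"
    by (meson sum.not_neutral_contains_not_neutral)
  then obtain p j where pj: "(p, j) \<in> primary_pairs d" "walk_count ev d k (\<beta> / ev p ^ j) \<noteq> 0"
    by (cases t) auto
  obtain xs where xs: "length xs = k" "set xs \<subseteq> E_set \<iota> \<alpha> d" "prod_list xs = \<beta> / ev p ^ j"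
    using Suc.IH[OF pj(2)] by blast
  have "ev p ^ j \<in> E_set \<iota> \<alpha> d"
    using P_set_primary_pairs[OF pj(1) assms(2)] unfolding E_set_def ev_power[symmetric] by blast
  then show ?case using xs ev_primary_pair_nonzero[OF pj(1) assms(3)]
    by (intro exI[of _ "ev p ^ j # xs"]) simp
qed

text \<open>Fourier inversion on the multiplicative group: one more factor is a convolution, which
  multiplies each Fourier coefficient by a \<open>primary_sum\<close>. The base case is
  orthogonality.\<close>

lemma walk_count_character_sum:
  assumes \<chi>: "\<And>k x y. k < M \<Longrightarrow> \<chi> k (x * y) = \<chi> k x * \<chi> k y" "\<And>k. k < M \<Longrightarrow> \<chi> k 1 = (1::complex)"
    "\<And>x. x \<noteq> 0 \<Longrightarrow> (\<Sum>k<M. \<chi> k x) = (if x = 1 then of_nat M else 0)"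
    and d: "0 < d" "d < n" and "\<beta> \<noteq> 0"
  shows "of_nat M * of_nat (walk_count ev d m \<beta>) =
    (\<Sum>k<M. \<chi> k (inverse \<beta>) * primary_sum (\<lambda>g. \<chi> k (ev g)) d ^ m)"
  using \<open>\<beta> \<noteq> 0\<close>
proof (induction m arbitrary: \<beta>)
  case 0
  then show ?case using \<chi>(3)[of "inverse \<beta>"] by simp
next
  case (Suc m)
  have pow: "\<chi> k (x ^ j) = \<chi> k x ^ j" if "k < M" for k x j
    using that by (induction j) (simp_all add: \<chi>)
  have "of_nat M * of_nat (walk_count ev d (Suc m) \<beta>) =
      (\<Sum>(p, j)\<in>primary_pairs d. of_nat (degree p) *
        (of_nat M * of_nat (walk_count ev d m (\<beta> / ev p ^ j))) :: complex)"
    by (simp add: sum_distrib_left case_prod_unfold mult_ac)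
  also have "\<dots> = (\<Sum>(p, j)\<in>primary_pairs d. \<Sum>k<M.
      \<chi> k (inverse \<beta>) * primary_sum (\<lambda>g. \<chi> k (ev g)) d ^ m * (of_nat (degree p) * \<chi> k (ev p) ^ j))"
  proof (intro sum.cong refl, clarify)
    fix p :: "'a poly" and j assume pj: "(p, j) \<in> primary_pairs d"
    have nz: "ev p ^ j \<noteq> 0" using ev_primary_pair_nonzero[OF pj d(2)] .
    then have "of_nat (degree p) * (of_nat M * of_nat (walk_count ev d m (\<beta> / ev p ^ j))) =
        of_nat (degree p) * (\<Sum>k<M. \<chi> k (inverse (\<beta> / ev p ^ j)) * primary_sum (\<lambda>g. \<chi> k (ev g)) d ^ m)"
      using Suc.prems by (subst Suc.IH) auto
    also have "\<dots> = (\<Sum>k<M. \<chi> k (inverse \<beta>) * primary_sum (\<lambda>g. \<chi> k (ev g)) d ^ m *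
        (of_nat (degree p) * \<chi> k (ev p) ^ j))"
      unfolding sum_distrib_left
    proof (intro sum.cong refl)
      fix k assume "k \<in> {..<M}"
      then have k: "k < M" by simp
      have "inverse (\<beta> / ev p ^ j) = inverse \<beta> * ev p ^ j" by (simp add: field_simps)
      then have "\<chi> k (inverse (\<beta> / ev p ^ j)) = \<chi> k (inverse \<beta>) * \<chi> k (ev p) ^ j"
        using k by (simp only: \<chi>(1) pow)
      then show "of_nat (degree p) * (\<chi> k (inverse (\<beta> / ev p ^ j)) * primary_sum (\<lambda>g. \<chi> k (ev g)) d ^ m) =
          \<chi> k (inverse \<beta>) * primary_sum (\<lambda>g. \<chi> k (ev g)) d ^ m * (of_nat (degree p) * \<chi> k (ev p) ^ j)"
        by (simp only: mult_ac)
    qed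
    finally show "of_nat (degree p) * (of_nat M * of_nat (walk_count ev d m (\<beta> / ev p ^ j))) =
        (\<Sum>k<M. \<chi> k (inverse \<beta>) * primary_sum (\<lambda>g. \<chi> k (ev g)) d ^ m *
        (of_nat (degree p) * \<chi> k (ev p) ^ j))" .
  qed
  also have "\<dots> = (\<Sum>k<M. \<Sum>(p, j)\<in>primary_pairs d.
      \<chi> k (inverse \<beta>) * primary_sum (\<lambda>g. \<chi> k (ev g)) d ^ m * (of_nat (degree p) * \<chi> k (ev p) ^ j))"
    unfolding case_prod_unfold by (rule sum.swap)
  also have "\<dots> = (\<Sum>k<M. \<chi> k (inverse \<beta>) * primary_sum (\<lambda>g. \<chi> k (ev g)) d ^ Suc m)"
  proof (intro sum.cong refl)
    fix k
    have pull: "(\<Sum>(p, j)\<in>primary_pairs d. a * (of_nat (degree p) * \<chi> k (ev p) ^ j)) =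
        a * primary_sum (\<lambda>g. \<chi> k (ev g)) d" for a
      by (simp add: primary_sum_def case_prod_unfold sum_distrib_left)
    show "(\<Sum>(p, j)\<in>primary_pairs d. \<chi> k (inverse \<beta>) * primary_sum (\<lambda>g. \<chi> k (ev g)) d ^ m *
        (of_nat (degree p) * \<chi> k (ev p) ^ j)) = \<chi> k (inverse \<beta>) * primary_sum (\<lambda>g. \<chi> k (ev g)) d ^ Suc m"
      unfolding pull power_Suc by (simp only: mult_ac)
  qed
  finally show ?case .
qed

text \<open>In the Fourier formula the trivial character contributes \<open>(q ^ d) ^ m\<close> and
  every other one at most \<open>b ^ m\<close> in absolute value. There are fewer than
  \<open>q ^ n\<close> others, so they cannot cancel the main term.\<close>

lemma walk_count_nonzero:
  assumes d: "0 < d" "d < n" and \<beta>: "\<beta> \<noteq> 0"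
    and m: "real (q ^ n) * (real (n - 1) * sqrt (real q) ^ d) ^ m \<le> real (q ^ d) ^ m"
  shows "walk_count ev d m \<beta> \<noteq> 0"
proof
  assume zero: "walk_count ev d m \<beta> = 0"
  define M where "M = CARD('b) - 1"
  obtain \<chi> :: "nat \<Rightarrow> 'b \<Rightarrow> complex" where
    *: "\<And>k. k < M \<Longrightarrow> \<chi> k 0 = 0 \<and> \<chi> k 1 = 1 \<and> (\<forall>x y. \<chi> k (x * y) = \<chi> k x * \<chi> k y) \<and>
      (\<forall>x. cmod (\<chi> k x) \<le> 1) \<and>
      (\<forall>x. x \<noteq> 0 \<longrightarrow> \<chi> 0 x = 1) \<and> (k \<noteq> 0 \<longrightarrow> (\<Sum>x\<in>UNIV. \<chi> k x) = 0) \<and>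
      (\<forall>x. x \<noteq> 0 \<longrightarrow> (\<Sum>k<M. \<chi> k x) = (if x = 1 then of_nat M else 0))"
    using exists_characters[where ?'b = 'b] unfolding M_def by blast
  have q1: "q ^ n > 1" using one_less_power[OF q_gt_1, of n] n by simp
  then have M: "M > 0" by (simp add: M_def card_b)
  note trivial = *[OF M]
  define S where "S = (\<lambda>k. primary_sum (\<lambda>g. \<chi> k (ev g)) d)"
  define b where "b = real (n - 1) * sqrt (real q) ^ d"
  have b: "b > 0" using n q_gt_1 by (simp add: b_def)
  have "of_nat M * of_nat (walk_count ev d m \<beta>) = (\<Sum>k<M. \<chi> k (inverse \<beta>) * S k ^ m)"
    unfolding S_def
  proof (rule walk_count_character_sum[OF _ _ _ d \<beta>])
    show "\<chi> k (x * y) = \<chi> k x * \<chi> k y" if "k < M" for k x y using *[OF that] by blast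
    show "\<chi> k 1 = 1" if "k < M" for k using *[OF that] by blast
    show "(\<Sum>k<M. \<chi> k x) = (if x = 1 then of_nat M else 0)" if "x \<noteq> 0" for x using trivial that by blast
  qed
  also have "\<dots> = \<chi> 0 (inverse \<beta>) * S 0 ^ m + (\<Sum>k\<in>{..<M} - {0}. \<chi> k (inverse \<beta>) * S k ^ m)"
    using M by (intro sum.remove) auto
  also have "\<chi> 0 (inverse \<beta>) = 1" using trivial \<beta> by simp
  \<comment> \<open>As \<open>d < n\<close>, no \<open>p ^ j\<close> of degree \<open>d\<close>
    vanishes at \<open>\<alpha>\<close>, so the trivial character is 1 on every term.\<close>
  also have "S 0 = of_nat (q ^ d)"
  proof -
    have "S 0 = primary_sum (\<lambda>_::'a poly. 1) d"
      unfolding S_def primary_sum_def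
    proof (intro sum.cong refl, clarify)
      fix p :: "'a poly" and j assume pj: "(p, j) \<in> primary_pairs d"
      then have "ev p ^ j \<noteq> 0" using d by (intro ev_primary_pair_nonzero)
      moreover have "j > 0" using pj by (simp add: primary_pairs_def)
      ultimately have "\<chi> 0 (ev p) = 1" using trivial by simp
      then show "of_nat (degree p) * \<chi> 0 (ev p) ^ j = of_nat (degree p) * 1 ^ j" by simp
    qed
    then show ?thesis using primary_sum_one[of d, where ?'a = 'a] d by (simp add: q_def)
  qed
  finally have "of_nat (q ^ d) ^ m = - (\<Sum>k\<in>{..<M} - {0}. \<chi> k (inverse \<beta>) * S k ^ m)"
    using zero by (simp add: eq_neg_iff_add_eq_0)
  then have "real (q ^ d) ^ m = cmod (\<Sum>k\<in>{..<M} - {0}. \<chi> k (inverse \<beta>) * S k ^ m)"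
    by (metis norm_minus_cancel norm_of_nat norm_power)
  also have "\<dots> \<le> (\<Sum>k\<in>{..<M} - {0}. 1 * b ^ m)"
  proof (rule order_trans[OF norm_sum], rule sum_mono)
    fix k assume k: "k \<in> {..<M} - {0}"
    then have \<chi>k: "k < M" "k \<noteq> 0" by auto
    note char = *[OF \<chi>k(1)]
    have "cmod (S k) \<le> b"
      unfolding S_def b_def using char \<chi>k(2) d by (intro character_sum_bound) auto
    then show "cmod (\<chi> k (inverse \<beta>) * S k ^ m) \<le> 1 * b ^ m"
      unfolding norm_mult norm_power using char by (intro mult_mono power_mono) auto
  qed
  also have "\<dots> < real (q ^ n) * b ^ m"
  proof -
    have "card ({..<M} - {0}) < q ^ n" using q1 by (simp add: M_def card_b)
    then show ?thesis using b by simp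
  qed
  finally show False using m by (simp add: b_def)
qed

end

text \<open>After taking logarithms the claim reads 2nu \<le> mD. The hypothesis n - 1 < q^(d/2)
  makes \<open>D\<close> positive, and the lower bound on \<open>m\<close> equals 2nu / D.\<close>

lemma diameter_exponent_inequality:
  fixes n d q m :: nat
  assumes n: "n > 1" and d: "d \<ge> 1" and q: "q > 1" and nd: "real n < real q powr (real d / 2) + 1"
    and m: "real m \<ge> 2 * (real n / real d) +
      4 * (real n / real d) * ln (real n - 1) / (real d * ln (real q) - 2 * ln (real n - 1))"
  shows "real (q ^ n) * (real (n - 1) * sqrt (real q) ^ d) ^ m \<le> real (q ^ d) ^ m"
proof -
  define u where "u = ln (real q)"
  define v where "v = ln (real n - 1)"
  define D where "D = real d * u - 2 * v"
  have n1: "real (n - 1) = real n - 1" "real n - 1 > 0" using n by auto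
  have "v < ln (real q powr (real d / 2))" unfolding v_def using n1 nd q by (subst ln_less_cancel_iff) auto
  then have "v < real d / 2 * u" using q by (simp add: u_def ln_powr)
  then have D: "D > 0" by (simp add: D_def)
  have "2 * (real n / real d) + 4 * (real n / real d) * v / D = 2 * real n * u / D"
  proof -
    have "2 * (real n / real d) + 4 * (real n / real d) * v / D = 2 * (real n / real d) * (D + 2 * v) / D"
      using D d by (simp add: field_simps)
    also have "D + 2 * v = real d * u" by (simp add: D_def)
    also have "2 * (real n / real d) * (real d * u) / D = 2 * real n * u / D" using d by simp
    finally show ?thesis .
  qed
  then have "2 * real n * u / D \<le> real m" using m by (simp add: u_def v_def D_def)
  then have "2 * real n * u \<le> real m * D" using D by (simp add: divide_le_eq)
  then have le: "real n * u + real m * (v + real d * (u / 2)) \<le> real m * (real d * u)"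
    by (simp add: D_def algebra_simps)
  have q0: "real q > 0" using q by simp
  have "ln (real (q ^ n) * (real (n - 1) * sqrt (real q) ^ d) ^ m) = real n * u + real m * (v + real d * (u / 2))"
    using q0 n1 by (simp add: ln_mult ln_realpow ln_sqrt u_def v_def)
  moreover have "ln (real (q ^ d) ^ m) = real m * (real d * u)"
    using q0 by (simp add: ln_realpow u_def)
  ultimately have "ln (real (q ^ n) * (real (n - 1) * sqrt (real q) ^ d) ^ m) \<le> ln (real (q ^ d) ^ m)"
    using le by simp
  then show ?thesis using q0 n1 by (subst (asm) ln_le_cancel_iff) auto
qed

theorem theorem15:
  fixes \<iota> :: "'a::{field,finite} \<Rightarrow> 'b::{field,finite}"
    and f :: "'a poly" and \<alpha> :: 'b and q n d :: nat
  assumes "CARD('a) = q" and "CARD('b) = q ^ n" and "field_hom \<iota>"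
    and "n > 1" and "1 \<le> d" and "d < n"
    and "irreducible f" and "degree f = n" and "eval_at \<iota> \<alpha> f = 0"
    and "real n < real q powr (real d / 2) + 1"
  shows "ereal_of_enat (G_diameter \<iota> \<alpha> d) \<le>
    ereal (2 * (real n / real d) + 1 +
      (4 * (real n / real d) * ln (real n - 1)) / (real d * ln (real q) - 2 * ln (real n - 1)))"
    (is "_ \<le> ereal ?B")
proof -
  interpret generated_extension \<iota> f \<alpha> q n
    by (rule generated_extension.intro) (use assms in simp_all)
  have v: "ln (real n - 1) \<ge> 0" using \<open>n > 1\<close> by simp
  have "ln (real n - 1) < ln (real q powr (real d / 2))"
    using assms(4,10) q_gt_1 by (subst ln_less_cancel_iff) auto
  then have D: "real d * ln (real q) - 2 * ln (real n - 1) > 0" using q_gt_1 by (simp add: ln_powr)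
  \<comment> \<open>Rounding down loses less than 1, which the summand 1 in the bound
    absorbs.\<close>
  define m where "m = nat \<lfloor>?B\<rfloor>"
  have B0: "?B \<ge> 0" using v D by simp
  then have mB: "real m \<le> ?B" "?B - 1 \<le> real m" by (auto simp: m_def) linarith+
  have ineq: "real (q ^ n) * (real (n - 1) * sqrt (real q) ^ d) ^ m \<le> real (q ^ d) ^ m"
    by (rule diameter_exponent_inequality) (use assms q_gt_1 mB(2) in simp_all)
  have "\<exists>xs. length xs \<le> m \<and> set xs \<subseteq> E_set \<iota> \<alpha> d \<and> prod_list xs = \<beta>" if "\<beta> \<in> Gamma_set \<iota> \<alpha>" for \<beta>
  proof -
    have "\<beta> \<noteq> 0" using that by (auto simp: Gamma_set_def)
    then have "walk_count ev d m \<beta> \<noteq> 0" using assms ineq by (intro walk_count_nonzero) auto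
    then show ?thesis using product_of_walk_count[of d m \<beta>] assms by auto
  qed
  then have "G_diameter \<iota> \<alpha> d \<le> enat m" unfolding G_diameter_def by (intro Inf_lower) auto
  then have "ereal_of_enat (G_diameter \<iota> \<alpha> d) \<le> ereal_of_enat (enat m)"
    by (simp only: ereal_of_enat_le_iff)
  also have "\<dots> \<le> ereal ?B" using mB(1) by simp
  finally show ?thesis .
qed

end
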